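(* Let $G$ be a Polish group and let $F\leqslant G$ be a universally measurable subgroup. Then either $F$ is open in $G$ or $F$ has perfect index in $G$. Consequently, for every Polish group $G$, every universally measurable group homomorphism $\pi\colon G\to S_\infty$ is continuous.
   Context: A Polish space is a separable topological space whose topology can be induced by a complete metric; a topological group is Polish if its topology is Polish. A subset $A$ of a Polish space $X$ is universally measurable if for every Borel probability measure $\mu$ on $X$ the set $A$ is $\mu$-measurable, i.e., $A$ differs from a Borel set by a set of $\mu$-measure $0$. A function $f\colon X\to Y$ between Polish spaces is universally measurable if $f^{-1}(U)$ is universally measurable in $X$ for every open $U\subseteq Y$. A subset $A$ of a Polish group $G$ admits a perfect set of disjoint left translates if there is a non-empty perfect set $C\subseteq G$ (closed, without isolated points) such that $xA\cap yA=\emptyset$ for all $x\neq y$ in $C$. A subgroup $K$ of $G$ has perfect index if it admits a perfect set of disjoint left translates. $S_\infty$ is the group of all permutations of $\mathbb{N}$ with the Polish topology whose basic open sets are $\{g\in S_\infty : g(n_i)=m_i,\ i\leqslant k\}$, where $n_1,\ldots,n_k,m_1,\ldots,m_k$ are natural numbers. *)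

theory Defs
  imports "HOL-Algebra.Bij" "HOL-Algebra.Coset" "HOL-Probability.Probability_Measure"
    "HOL-Analysis.Abstract_Metric_Spaces"
begin

definition polish_topology :: "'a topology \<Rightarrow> bool"
  where "polish_topology X \<longleftrightarrow> separable_space X \<and> completely_metrizable_space X"

locale polish_group = group G for G (structure) and T +
  assumes topspace_eq_carrier: "topspace T = carrier G"
    and continuous_mult: "continuous_map (prod_topology T T) T (\<lambda>(x, y). x \<otimes> y)"
    and continuous_inv: "continuous_map T T (\<lambda>x. inv x)"
    and polish: "polish_topology T"

definition borel_sets_of :: "'a topology \<Rightarrow> 'a set set"
  where "borel_sets_of X = sigma_sets (topspace X) {U. openin X U}"

definition borel_prob_measure :: "'a topology \<Rightarrow> 'a measure \<Rightarrow> bool"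
  where "borel_prob_measure X \<mu> \<longleftrightarrow>
    prob_space \<mu> \<and> space \<mu> = topspace X \<and> sets \<mu> = borel_sets_of X"

text \<open>The symmetric difference need not be Borel, so its having measure zero refers to the
  completion of the measure, i.e. it is contained in a Borel set of measure zero.\<close>

definition universally_measurable :: "'a topology \<Rightarrow> 'a set \<Rightarrow> bool"
  where "universally_measurable X A \<longleftrightarrow>
    A \<subseteq> topspace X \<and>
    (\<forall>\<mu>. borel_prob_measure X \<mu> \<longrightarrow>
      (\<exists>B \<in> borel_sets_of X. sym_diff A B \<in> null_sets (completion \<mu>)))"

definition universally_measurable_map :: "'a topology \<Rightarrow> 'b topology \<Rightarrow> ('a \<Rightarrow> 'b) \<Rightarrow> bool"
  where "universally_measurable_map X Y f \<longleftrightarrow>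
    f \<in> topspace X \<rightarrow> topspace Y \<and>
    (\<forall>U. openin Y U \<longrightarrow> universally_measurable X {x \<in> topspace X. f x \<in> U})"

text \<open>The empty set is perfect in this sense; non-emptiness is demanded separately below.\<close>

definition perfect_set :: "'a topology \<Rightarrow> 'a set \<Rightarrow> bool"
  where "perfect_set X C \<longleftrightarrow> closedin X C \<and> C \<subseteq> X derived_set_of C"

definition perfect_set_of_disjoint_left_translates ::
    "('a, 'b) monoid_scheme \<Rightarrow> 'a topology \<Rightarrow> 'a set \<Rightarrow> bool"
  where "perfect_set_of_disjoint_left_translates G T A \<longleftrightarrow>
    (\<exists>C. C \<noteq> {} \<and> perfect_set T C \<and>
      (\<forall>x\<in>C. \<forall>y\<in>C. x \<noteq> y \<longrightarrow> (x <#\<^bsub>G\<^esub> A) \<inter> (y <#\<^bsub>G\<^esub> A) = {}))"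

definition has_perfect_index :: "('a, 'b) monoid_scheme \<Rightarrow> 'a topology \<Rightarrow> 'a set \<Rightarrow> bool"
  where "has_perfect_index G T K \<longleftrightarrow>
    subgroup K G \<and> perfect_set_of_disjoint_left_translates G T K"

definition S_inf :: "(nat \<Rightarrow> nat) monoid"
  where "S_inf = BijGroup UNIV"

lemma carrier_S_inf: "carrier S_inf = {g. bij g}"
  by (auto simp: S_inf_def BijGroup_def Bij_def)

lemma mult_S_inf: "bij g \<Longrightarrow> bij h \<Longrightarrow> g \<otimes>\<^bsub>S_inf\<^esub> h = g \<circ> h"
  by (auto simp: S_inf_def BijGroup_def Bij_def compose_def)

text \<open>The finite set \<open>P\<close> consists of the pairs (n_i, m_i) prescribing g(n_i) = m_i.\<close>

definition S_inf_basic_open :: "(nat \<times> nat) set \<Rightarrow> (nat \<Rightarrow> nat) set"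
  where "S_inf_basic_open P = {g \<in> carrier S_inf. \<forall>(n, m) \<in> P. g n = m}"

definition S_inf_topology :: "(nat \<Rightarrow> nat) topology"
  where "S_inf_topology = topology_generated_by {S_inf_basic_open P |P. finite P}"

lemma topspace_S_inf_topology: "topspace S_inf_topology = carrier S_inf"
proof -
  have "S_inf_basic_open {} = carrier S_inf"
    by (simp add: S_inf_basic_open_def)
  then have "carrier S_inf \<in> {S_inf_basic_open P |P. finite P}"
    by (metis (mono_tags, lifting) finite.emptyI mem_Collect_eq)
  moreover have "S_inf_basic_open P \<subseteq> carrier S_inf" for P
    by (auto simp: S_inf_basic_open_def)
  ultimately show ?thesis
    unfolding S_inf_topology_def topology_generated_by_topspace by blast
qed

end

theory Submission
  imports Defs "HOL-Probability.Probability"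
begin

text \<open>
  Fix a universally measurable subgroup \<open>F\<close> of a Polish group. Suppose first that arbitrarily close
  to the identity there are elements lying outside any finitely many prescribed conjugates of \<open>F\<close>.
  Then one can choose such elements \<open>g 0, g 1, ...\<close> tending to the identity so fast that all infinite
  subproducts \<open>\<phi> x = g 0 ^ x 0 * g 1 ^ x 1 * ...\<close>, for \<open>x\<close> in the Cantor space, converge and depend
  continuously on \<open>x\<close>, while changing a single bit of \<open>x\<close> always moves \<open>\<phi> x\<close> to another right coset
  of \<open>F\<close> (\<open>convergent_products\<close>). The relation ``\<open>\<phi> x\<close> and \<open>\<phi> y\<close> lie in the same right coset'' is
  measurable for the coin-tossing measure, because \<open>F\<close> is universally measurable. A measurable set
  is nearly determined by finitely many coordinates, so a relation destroyed by flipping any one bit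
  of \<open>y\<close> is null (\<open>measure_zero_if_flip_disjoint\<close>). A null relation has a Cantor set of
  pairwise unrelated points, found as the set of branches of a random tree
  (\<open>perfect_set_avoiding_null\<close>). The inverses of its values under \<open>\<phi>\<close> form a perfect set of
  representatives of different left cosets of \<open>F\<close>.

  Otherwise finitely many conjugates of \<open>F\<close> cover a neighbourhood of the identity. A local version
  of Neumann's lemma on coverings by cosets (\<open>local_neumann\<close>) then shows that already finitely many
  cosets of \<open>F\<close> cover one. In this case \<open>F\<close> has finite index in its closure \<open>H\<close>, and \<open>H\<close> is open.
  The construction above, carried out in \<open>H\<close> for the intersection of all \<open>H\<close>-conjugates of \<open>F\<close>,
  would produce infinitely many cosets of a subgroup of finite index unless \<open>F\<close> is open
  (\<open>open_if_locally_finite_index\<close>).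

  For a homomorphism into the infinite symmetric group, the preimage of the stabiliser of a natural
  number has countable index, hence no perfect set of coset representatives, hence is open; and
  cosets of these preimages generate the preimages of all open sets.
\<close>

section \<open>Fair coin tossing on a binary cube\<close>

definition depends_on :: "'i set \<Rightarrow> ('i \<Rightarrow> bool) set \<Rightarrow> bool"
  where "depends_on J V \<longleftrightarrow> (\<forall>z w. (\<forall>i\<in>J. z i = w i) \<longrightarrow> (z \<in> V \<longleftrightarrow> w \<in> V))"

definition cylinders :: "('i \<Rightarrow> bool) set set"
  where "cylinders = {V. \<exists>J. finite J \<and> depends_on J V}"

definition cyl :: "'i set \<Rightarrow> ('i \<Rightarrow> bool) \<Rightarrow> ('i \<Rightarrow> bool) set"
  where "cyl J v = {z. \<forall>i\<in>J. z i = v i}"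

definition coin :: "('i \<Rightarrow> bool) measure"
  where "coin = PiM UNIV (\<lambda>_. measure_pmf (pmf_of_set UNIV))"

interpretation coin_factor: product_prob_space "\<lambda>_::'i. measure_pmf (pmf_of_set (UNIV::bool set))" UNIV
  by unfold_locales

interpretation coin: prob_space "coin :: ('i \<Rightarrow> bool) measure"
  unfolding coin_def by (rule prob_space_PiM) (rule measure_pmf.prob_space_axioms)

lemma space_coin [simp]: "space coin = UNIV"
  by (simp add: coin_def space_PiM)

lemma depends_onD: "depends_on J V \<Longrightarrow> (\<And>i. i \<in> J \<Longrightarrow> z i = w i) \<Longrightarrow> z \<in> V \<longleftrightarrow> w \<in> V"
  unfolding depends_on_def by metis

lemma depends_onI:
  assumes "\<And>z w. (\<And>i. i \<in> J \<Longrightarrow> z i = w i) \<Longrightarrow> z \<in> V \<longleftrightarrow> w \<in> V"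
  shows "depends_on J V"
  unfolding depends_on_def by (intro allI impI, rule assms, erule bspec)

lemma depends_on_mono: "depends_on J V \<Longrightarrow> J \<subseteq> K \<Longrightarrow> depends_on K V"
  by (rule depends_onI) (rule depends_onD, auto)

text \<open>The cylinders are the clopen sets of the cube; being an algebra that generates the
  measurable sets, they approximate every measurable set.\<close>

lemma algebra_cylinders: "algebra UNIV cylinders"
proof -
  have un: "V \<union> W \<in> cylinders" if "V \<in> cylinders" "W \<in> cylinders" for V W :: "('a \<Rightarrow> bool) set"
  proof -
    obtain J K where "finite J" "depends_on J V" "finite K" "depends_on K W"
      using \<open>V \<in> cylinders\<close> \<open>W \<in> cylinders\<close> by (auto simp: cylinders_def)
    then have fin: "finite (J \<union> K)" and V: "depends_on (J \<union> K) V" and W: "depends_on (J \<union> K) W"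
      by (simp_all add: depends_on_mono)
    have "depends_on (J \<union> K) (V \<union> W)"
    proof (rule depends_onI)
      fix z w :: "'a \<Rightarrow> bool" assume "\<And>i. i \<in> J \<union> K \<Longrightarrow> z i = w i"
      then have "z \<in> V \<longleftrightarrow> w \<in> V" "z \<in> W \<longleftrightarrow> w \<in> W"
        using depends_onD[OF V, of z w] depends_onD[OF W, of z w] by blast+
      then show "z \<in> V \<union> W \<longleftrightarrow> w \<in> V \<union> W" by simp
    qed
    with fin show ?thesis unfolding cylinders_def by blast
  qed
  have compl: "- V \<in> cylinders" if "V \<in> cylinders" for V :: "('a \<Rightarrow> bool) set"
  proof -
    obtain J where J: "finite J" "depends_on J V"
      using \<open>V \<in> cylinders\<close> by (auto simp: cylinders_def)
    have "depends_on J (- V)"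
    proof (intro depends_onI)
      fix z w :: "'a \<Rightarrow> bool" assume "\<And>i. i \<in> J \<Longrightarrow> z i = w i"
      then have "z \<in> V \<longleftrightarrow> w \<in> V" by (rule depends_onD[OF J(2)])
      then show "z \<in> - V \<longleftrightarrow> w \<in> - V" by simp
    qed
    with J show ?thesis unfolding cylinders_def by blast
  qed
  have "{} \<in> cylinders"
    by (auto simp: cylinders_def depends_on_def)
  then show ?thesis
    using un compl by (simp add: algebra_iff_Un Compl_eq_Diff_UNIV)
qed

lemma depends_on_eq_UN_cyl:
  assumes "depends_on J V"
  shows "V = (\<Union>v\<in>{v\<in>V. \<forall>i. i \<notin> J \<longrightarrow> \<not> v i}. cyl J v)"
proof (intro equalityI subsetI)
  fix z assume z: "z \<in> V"
  let ?v = "\<lambda>i. i \<in> J \<and> z i"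
  have "?v \<in> V" using depends_onD[OF assms, of ?v z] z by simp
  then show "z \<in> (\<Union>v\<in>{v\<in>V. \<forall>i. i \<notin> J \<longrightarrow> \<not> v i}. cyl J v)"
    by (intro UN_I[of ?v]) (auto simp: cyl_def)
next
  fix z assume "z \<in> (\<Union>v\<in>{v\<in>V. \<forall>i. i \<notin> J \<longrightarrow> \<not> v i}. cyl J v)"
  then obtain v where "v \<in> V" "z \<in> cyl J v" by blast
  then show "z \<in> V" using depends_onD[OF assms, of z v] by (simp add: cyl_def)
qed

lemma finite_supported_on:
  assumes "finite J"
  shows "finite {v :: 'i \<Rightarrow> bool. \<forall>i. i \<notin> J \<longrightarrow> \<not> v i}" (is "finite ?S")
    and "card {v :: 'i \<Rightarrow> bool. \<forall>i. i \<notin> J \<longrightarrow> \<not> v i} = 2 ^ card J"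
proof -
  have "bij_betw (\<lambda>v. {i. v i}) ?S (Pow J)"
    by (rule bij_betw_byWitness[where f' = "\<lambda>A i. i \<in> A"]) auto
  then show "finite ?S" "card ?S = 2 ^ card J"
    using assms by (simp_all add: bij_betw_finite bij_betw_same_card card_Pow)
qed

lemma
  assumes "finite J"
  shows sets_cyl: "cyl J v \<in> sets coin"
    and measure_cyl: "measure coin (cyl J v) = (1/2) ^ card J"
proof -
  have eq: "cyl J v = {z \<in> space coin. \<forall>i\<in>J. z i \<in> {v i}}"
    by (auto simp: cyl_def)
  have "(\<lambda>z. z i) -` {v i} \<inter> space coin \<in> sets coin" for i
    unfolding coin_def by (rule measurable_sets[OF measurable_component_singleton]) auto
  then have "{z \<in> space coin. z i = v i} \<in> sets coin" for i
    by (simp add: vimage_def)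
  then show "cyl J v \<in> sets coin"
    unfolding eq using assms by (intro sets.sets_Collect_finite_All) auto
  have "emeasure coin (cyl J v) = (\<Prod>i\<in>J. emeasure (measure_pmf (pmf_of_set (UNIV::bool set))) {v i})"
    unfolding eq coin_def using assms by (intro coin_factor.emeasure_PiM_Collect) auto
  also have "\<dots> = (\<Prod>i\<in>J. ennreal (1/2))"
    by (simp add: emeasure_pmf_single pmf_of_set)
  also have "\<dots> = ennreal (\<Prod>i\<in>J. 1/2)"
    by (rule prod_ennreal) simp
  finally show "measure coin (cyl J v) = (1/2) ^ card J"
    by (simp add: measure_def power_one_over)
qed

lemma
  assumes J: "finite J" and V: "depends_on J V"
  shows sets_depends_on: "V \<in> sets coin"
    and measure_depends_on: "measure coin V = card {v\<in>V. \<forall>i. i \<notin> J \<longrightarrow> \<not> v i} * (1/2) ^ card J"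
proof -
  let ?S = "{v\<in>V. \<forall>i. i \<notin> J \<longrightarrow> \<not> v i}"
  have fin: "finite ?S"
    by (rule finite_subset[OF _ finite_supported_on(1)[OF J]]) auto
  note eq = depends_on_eq_UN_cyl[OF V]
  show "V \<in> sets coin"
    by (subst eq) (intro sets.finite_UN fin sets_cyl J)
  have "disjoint_family_on (cyl J) ?S"
  unfolding disjoint_family_on_def
  proof (intro ballI impI)
    fix v w assume vw: "v \<in> ?S" "w \<in> ?S" "v \<noteq> w"
    then obtain i where "v i \<noteq> w i" by (auto simp: fun_eq_iff)
    with vw have "i \<in> J" by auto
    with \<open>v i \<noteq> w i\<close> show "cyl J v \<inter> cyl J w = {}" by (auto simp: cyl_def)
  qed
  then have "measure coin (\<Union>v\<in>?S. cyl J v) = (\<Sum>v\<in>?S. measure coin (cyl J v))"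
    by (intro coin.finite_measure_finite_Union fin) (auto intro: sets_cyl J)
  with eq show "measure coin V = card ?S * (1/2) ^ card J"
    by (simp add: measure_cyl[OF J])
qed

lemma sets_coin: "sets coin = sigma_sets UNIV cylinders"
proof
  show "sigma_sets UNIV cylinders \<subseteq> sets (coin :: ('a \<Rightarrow> bool) measure)"
    using sets.sigma_sets_subset[of cylinders coin] sets_depends_on
    by (auto simp: cylinders_def)
  have "{z. z i \<in> A} \<in> sigma_sets UNIV cylinders" for i :: 'a and A
    by (rule sigma_sets.Basic) (auto simp: cylinders_def depends_on_def intro!: exI[of _ "{i}"])
  then show "sets (coin :: ('a \<Rightarrow> bool) measure) \<subseteq> sigma_sets UNIV cylinders"
    unfolding coin_def sets_PiM_single by (auto intro!: sigma_sets_mono simp: PiE_UNIV_domain)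
qed

text \<open>Flipping one coordinate preserves the measure, and it does not move a cylinder that depends
  on other coordinates only. Both facts together drive the nullity argument below.\<close>

definition flip :: "'i \<Rightarrow> ('i \<Rightarrow> bool) \<Rightarrow> 'i \<Rightarrow> bool"
  where "flip i z = z(i := \<not> z i)"

lemma flip_flip [simp]: "flip i (flip i z) = z"
  by (simp add: flip_def)

lemma measurable_flip: "flip (i :: 'i) \<in> coin \<rightarrow>\<^sub>M coin"
  unfolding coin_def
proof (rule measurable_PiM_single')
  fix j :: 'i
  have c: "(\<lambda>z. z j) \<in> coin \<rightarrow>\<^sub>M count_space UNIV"
    unfolding coin_def by (rule measurable_component_singleton[of _ _ "\<lambda>_. measure_pmf _", simplified])
       simp
  show "(\<lambda>z. flip i z j) \<in> Pi\<^sub>M UNIV (\<lambda>_. measure_pmf (pmf_of_set UNIV)) \<rightarrow>\<^sub>M measure_pmf (pmf_of_set UNIV)"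
    using c by (cases "i = j") (auto simp: flip_def coin_def)
qed auto

lemma distr_flip: "distr coin coin (flip (i :: 'i)) = coin"
proof -
  have half: "emeasure (measure_pmf (pmf_of_set UNIV)) (Not -` A) = emeasure (measure_pmf (pmf_of_set UNIV)) A" for A
  proof -
    have "card (Not -` A) = card A"
      by (rule card_vimage_inj) (auto simp: inj_def intro: image_eqI[of _ _ "\<not> _"])
    then show ?thesis by (simp add: emeasure_pmf_of_set)
  qed
  show ?thesis
    unfolding coin_def
  proof (rule coin_factor.PiM_eq)
    fix J :: "'i set" and X :: "'i \<Rightarrow> bool set"
    assume J: "finite J"
    let ?Y = "\<lambda>j. if j = i then Not -` X j else X j"
    have "flip i -` (prod_emb UNIV (\<lambda>_. measure_pmf (pmf_of_set UNIV)) J (Pi\<^sub>E J X))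
        = {z \<in> space coin. \<forall>j\<in>J. z j \<in> ?Y j}"
    proof (rule Set.set_eqI)
      fix z
      have "flip i z j \<in> X j \<longleftrightarrow> z j \<in> ?Y j" for j
        by (simp add: flip_def)
      then show "z \<in> flip i -` (prod_emb UNIV (\<lambda>_. measure_pmf (pmf_of_set UNIV)) J (Pi\<^sub>E J X)) \<longleftrightarrow>
          z \<in> {z \<in> space coin. \<forall>j\<in>J. z j \<in> ?Y j}"
        by (simp add: prod_emb_def space_PiM PiE_iff)
    qed
    then show "emeasure (distr (Pi\<^sub>M UNIV (\<lambda>_. measure_pmf (pmf_of_set UNIV))) (Pi\<^sub>M UNIV (\<lambda>_. measure_pmf (pmf_of_set UNIV))) (flip i))
            (prod_emb UNIV (\<lambda>_. measure_pmf (pmf_of_set UNIV)) J (Pi\<^sub>E J X)) =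
           (\<Prod>j\<in>J. emeasure (measure_pmf (pmf_of_set UNIV)) (X j))"
      using measurable_flip[of i] J coin_factor.emeasure_PiM_Collect[of J ?Y]
      by (subst emeasure_distr) (auto simp: coin_def half intro!: prod.cong sets_PiM_I)
  qed simp
qed

section \<open>Covering measurable sets by cylinders\<close>

text \<open>The outer measure obtained from the algebra is itself a measure on the generated
  sigma-algebra, hence by uniqueness of extensions it is the given measure; and an outer measure
  is by construction an infimum over countable covers.\<close>

lemma algebra_cover:
  assumes "finite_measure M" "algebra (space M) \<C>" "sets M = sigma_sets (space M) \<C>"
    and S: "S \<in> sets M" and e: "e > 0"
  obtains A :: "nat \<Rightarrow> 'a set" where "range A \<subseteq> \<C>" "S \<subseteq> (\<Union>i. A i)"
    "(\<Sum>i. emeasure M (A i)) \<le> emeasure M S + ennreal e"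
proof -
  interpret finite_measure M by fact
  interpret C: algebra "space M" \<C> by fact
  let ?O = "outer_measure \<C> (emeasure M)"
  have sub: "\<C> \<subseteq> sets M" using assms(3) by auto
  have pos: "positive \<C> (emeasure M)" by (simp add: positive_def)
  have ca: "countably_additive \<C> (emeasure M)"
    using sub countably_additive_def[of \<C>] by (auto intro!: suminf_emeasure)
  have inc: "increasing \<C> (emeasure M)"
    using sub by (auto simp: increasing_def intro!: emeasure_mono)
  have mls: "measure_space (space M) (lambda_system (space M) (Pow (space M)) ?O) ?O"
    using sigma_algebra.caratheodory_lemma
            [OF sigma_algebra_Pow C.outer_measure_space_outer_measure [OF pos inc]] by simp
  have "\<C> \<subseteq> lambda_system (space M) (Pow (space M)) ?O"
    using C.algebra_subset_lambda_system[OF pos inc] ca C.countably_additive_additive pos by metis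
  then have ss: "sigma_sets (space M) \<C> \<subseteq> lambda_system (space M) (Pow (space M)) ?O"
    using mls unfolding measure_space_def by (intro sigma_algebra.sigma_sets_subset) auto
  have ms: "measure_space (space M) (sigma_sets (space M) \<C>) ?O"
    by (rule measure_down[OF mls sigma_algebra_sigma_sets ss]) (rule C.space_closed)
  define M' where "M' = measure_of (space M) \<C> ?O"
  have em: "emeasure M' X = ?O X" if "X \<in> sigma_sets (space M) \<C>" for X
    using emeasure_measure_of_sigma[of "space M" "sigma_sets (space M) \<C>" ?O X] ms that C.space_closed
    unfolding M'_def measure_space_def
    by (simp add: emeasure_measure_of_conv measure_space_def)
  have "M' = M"
  proof (rule measure_eqI_generator_eq[where E=\<C> and \<Omega>="space M" and A="\<lambda>_. space M"])
    show "emeasure M' X = emeasure M X" if "X \<in> \<C>" for X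
      using em[of X] C.outer_measure_agrees[OF pos ca that] that by auto
    show "sets M' = sigma_sets (space M) \<C>"
      using C.space_closed by (simp add: M'_def)
    show "emeasure M' (space M) \<noteq> \<infinity>" for i :: nat
      using em[of "space M"] C.outer_measure_agrees[OF pos ca C.top] C.top by auto
  qed (use C.space_closed assms(3) in \<open>auto simp: Int_stable_def\<close>)
  then have O: "?O S = emeasure M S" using em[of S] S assms(3) by auto
  have "?O S < emeasure M S + ennreal e"
    unfolding O using e ennreal_add_left_cancel_less[of "emeasure M S" 0 "ennreal e"] by simp
  then obtain A where "range A \<subseteq> \<C>" "S \<subseteq> (\<Union>i. A i)" "(\<Sum>i. emeasure M (A i)) < emeasure M S + ennreal e"
    unfolding outer_measure_def by (auto simp: INF_less_iff)
  then show ?thesis using that by (meson less_imp_le)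
qed

lemma coin_cover:
  assumes S: "S \<in> sets coin" and e: "e > 0"
  obtains A :: "nat \<Rightarrow> ('i \<Rightarrow> bool) set" where "\<And>i. A i \<in> cylinders" "S \<subseteq> (\<Union>i. A i)"
    "summable (\<lambda>i. measure coin (A i))" "(\<Sum>i. measure coin (A i)) \<le> measure coin S + e"
proof -
  obtain A :: "nat \<Rightarrow> ('i \<Rightarrow> bool) set" where A: "range A \<subseteq> cylinders" "S \<subseteq> (\<Union>i. A i)"
    and le: "(\<Sum>i. emeasure coin (A i)) \<le> emeasure coin S + ennreal e"
    using algebra_cover[of coin cylinders S e] algebra_cylinders sets_coin S e
      coin.finite_measure_axioms by (metis space_coin)
  have le': "(\<Sum>i. ennreal (measure coin (A i))) \<le> ennreal (measure coin S + e)"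
    using le e by (simp add: coin.emeasure_eq_measure)
  then have nt: "(\<Sum>i. ennreal (measure coin (A i))) \<noteq> top_class.top"
    by (auto simp: top_unique)
  have sm: "summable (\<lambda>i. measure coin (A i))"
    by (rule summable_suminf_not_top[OF _ nt]) simp
  have "ennreal (\<Sum>i. measure coin (A i)) \<le> ennreal (measure coin S + e)"
    using le' unfolding suminf_ennreal[OF measure_nonneg nt] .
  then have "(\<Sum>i. measure coin (A i)) \<le> measure coin S + e"
    using e by (subst (asm) ennreal_le_iff) auto
  with A sm show ?thesis by (intro that[of A]) auto
qed

lemma sets_cylinders: "V \<in> cylinders \<Longrightarrow> V \<in> sets coin"
  by (auto simp: cylinders_def sets_depends_on)

lemma finite_UN_cylinders:
  "finite N \<Longrightarrow> (\<And>n. n \<in> N \<Longrightarrow> V n \<in> cylinders) \<Longrightarrow> (\<Union>n\<in>N. V n) \<in> cylinders"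
  using algebra_cylinders algebra.axioms(1) ring_of_sets.finite_UN by blast

lemma measure_flip_vimage:
  assumes "S \<in> sets coin"
  shows "measure coin (flip i -` S) = measure coin S" "flip i -` S \<in> sets coin"
proof -
  show "measure coin (flip i -` S) = measure coin S"
    using measure_distr[OF measurable_flip[of i] assms] by (simp add: distr_flip)
  show "flip i -` S \<in> sets coin"
    using measurable_sets[OF measurable_flip assms, of i] by simp
qed

text \<open>A measurable set is close to a cylinder \<open>V\<close>, which ignores almost all coordinates. Flipping a
  coordinate that \<open>V\<close> ignores leaves \<open>V\<close> fixed, so both \<open>S\<close> and its flip are almost contained in
  \<open>V\<close>, and \<open>V\<close> is hardly larger than \<open>S\<close>. If \<open>S\<close> and its flip are disjoint, this forces measure zero.\<close>

lemma measure_zero_if_flip_disjoint: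
  assumes S: "S \<in> sets coin" and I: "infinite I"
    and disj: "\<And>i z. i \<in> I \<Longrightarrow> z \<in> S \<Longrightarrow> flip i z \<notin> S"
  shows "measure coin S = 0"
proof -
  have "measure coin S \<le> 0 + e" if "e > 0" for e
  proof -
    \<comment> \<open>one \<open>\<epsilon>\<close> for \<open>V\<close> being too large, one each for the parts of \<open>S\<close> and of its flip outside \<open>V\<close>\<close>
    define \<epsilon> where "\<epsilon> = e / 3"
    have \<epsilon>: "\<epsilon> > 0" using that by (simp add: \<epsilon>_def)
    obtain A where A: "\<And>i. A i \<in> cylinders" and cov: "S \<subseteq> (\<Union>i. A i)"
      and sm: "summable (\<lambda>i. measure coin (A i))"
      and le: "(\<Sum>i. measure coin (A i)) \<le> measure coin S + \<epsilon>"
      using coin_cover[OF S \<epsilon>] by metis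
    note As [simp] = sets_cylinders[OF A]
    obtain N where N: "norm (\<Sum>i. measure coin (A (i + N))) < \<epsilon>"
      using suminf_exist_split[OF \<epsilon> sm] by blast
    define V where "V = (\<Union>i<N. A i)"
    have "V \<in> cylinders"
      unfolding V_def using A by (intro finite_UN_cylinders) auto
    then obtain J where J: "finite J" "depends_on J V"
      by (auto simp: cylinders_def)
    have Vs [simp]: "V \<in> sets coin" by (rule sets_cylinders) fact
    have V_le: "measure coin V \<le> measure coin S + \<epsilon>"
    proof -
      have "measure coin V \<le> measure coin (\<Union>i. A i)"
        unfolding V_def by (intro coin.finite_measure_mono) auto
      also have "\<dots> \<le> (\<Sum>i. measure coin (A i))"
        by (intro coin.finite_measure_subadditive_countably sm) auto
      finally show ?thesis using le by simp
    qed
    have SV: "measure coin (S - V) \<le> \<epsilon>"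
    proof -
      have "x \<in> (\<Union>i. A (i + N))" if "x \<in> S - V" for x
      proof -
        obtain j where "x \<in> A j" using cov \<open>x \<in> S - V\<close> by blast
        moreover have "\<not> j < N" using \<open>x \<in> S - V\<close> \<open>x \<in> A j\<close> by (auto simp: V_def)
        ultimately show ?thesis by (intro UN_I[of "j - N"]) auto
      qed
      then have "measure coin (S - V) \<le> measure coin (\<Union>i. A (i + N))"
        by (intro coin.finite_measure_mono) auto
      also have "\<dots> \<le> (\<Sum>i. measure coin (A (i + N)))"
        using summable_ignore_initial_segment[OF sm] by (intro coin.finite_measure_subadditive_countably) auto
      finally show ?thesis using N by simp
    qed
    obtain i where i: "i \<in> I" "i \<notin> J"
      using I J(1) by (meson finite_subset subsetI)
    have VV: "flip i -` V = V"
    proof (rule Set.set_eqI)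
      show "z \<in> flip i -` V \<longleftrightarrow> z \<in> V" for z
        unfolding vimage_def mem_Collect_eq
        by (rule depends_onD[OF J(2)]) (use i(2) in \<open>auto simp: flip_def\<close>)
    qed
    let ?S' = "flip i -` S"
    note S' = measure_flip_vimage[OF S, of i]
    have "flip i -` (S - V) = ?S' - V" using VV by auto
    then have SV': "measure coin (?S' - V) \<le> \<epsilon>"
      using measure_flip_vimage(1)[of "S - V" i] S SV sets.Diff[OF S Vs] by simp
    have "S \<inter> ?S' = {}" using disj[OF i(1)] by auto
    then have "2 * measure coin S = measure coin (S \<union> ?S')"
      using coin.finite_measure_Union[OF S S'(2)] S'(1) by simp
    also have "\<dots> \<le> measure coin (V \<union> ((S - V) \<union> (?S' - V)))"
      by (intro coin.finite_measure_mono sets.Un sets.Diff S S'(2) Vs) auto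
    also have "\<dots> \<le> measure coin V + (measure coin (S - V) + measure coin (?S' - V))"
      by (intro order_trans[OF measure_Un_le] add_mono measure_Un_le order_refl sets.Un sets.Diff S S'(2) Vs)
    finally show ?thesis using V_le SV SV' by (simp add: \<epsilon>_def)
  qed
  then have "measure coin S \<le> 0" by (rule field_le_epsilon)
  then show ?thesis by (simp add: measure_le_0_iff)
qed

lemma finite_strict_mono_le:
  fixes N :: "nat \<Rightarrow> nat"
  assumes N: "strict_mono N"
  shows "finite {n. N n \<le> i}"
proof (rule finite_subset)
  show "{n. N n \<le> i} \<subseteq> {..i}"
    using strict_mono_imp_increasing[OF N] le_trans by blast
qed simp

lemma strict_mono_block:
  fixes N :: "nat \<Rightarrow> nat"
  assumes N: "strict_mono N" and i: "N n\<^sub>0 \<le> i"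
  obtains n where "n \<ge> n\<^sub>0" "N n \<le> i" "i < N (Suc n)"
proof -
  note fin = finite_strict_mono_le[OF N, of i]
  let ?n = "Max {n. N n \<le> i}"
  have "N ?n \<le> i" "n\<^sub>0 \<le> ?n" "\<not> N (Suc ?n) \<le> i"
    using Max_in[OF fin] Max_ge[OF fin] i not_less_eq_eq by blast+
  then show ?thesis using that by simp
qed

text \<open>A converse of the Borel--Cantelli lemma. Taking one cover by cylinders of total measure at most
  \<open>(1/2)^k\<close> for each \<open>k\<close> and enumerating all of them together gives a summable sequence
  whose members contain every point of \<open>S\<close> infinitely often; uniting long blocks of it makes the measures
  decrease as fast as required.\<close>

lemma null_subset_limsup_cylinders:
  fixes S :: "('i \<Rightarrow> bool) set"
  assumes S: "S \<in> null_sets coin"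
  obtains V where "\<And>n. V n \<in> cylinders" "\<And>n. measure coin (V n) \<le> (1/8) ^ n"
    "\<And>z n\<^sub>0. z \<in> S \<Longrightarrow> \<exists>n\<ge>n\<^sub>0. z \<in> V n"
proof -
  have S0: "S \<in> sets coin" "emeasure coin S = 0" using S by auto
  have "\<exists>A. range A \<subseteq> cylinders \<and> S \<subseteq> (\<Union>i. A i) \<and> (\<Sum>i. emeasure coin (A i)) \<le> ennreal ((1/2)^k)"
    for k :: nat
  proof -
    have "algebra (space coin) cylinders" "sets coin = sigma_sets (space coin) cylinders"
      using algebra_cylinders sets_coin by simp_all
    then obtain A where "range A \<subseteq> cylinders" "S \<subseteq> (\<Union>i. A i)"
      "(\<Sum>i. emeasure coin (A i)) \<le> emeasure coin S + ennreal ((1/2)^k)"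
      using algebra_cover[OF coin.finite_measure_axioms _ _ S0(1), of cylinders "(1/2)^k"] by auto
    then show ?thesis using S0(2) by auto
  qed
  then obtain B :: "nat \<Rightarrow> nat \<Rightarrow> ('i \<Rightarrow> bool) set"
    where B: "\<And>k. range (B k) \<subseteq> cylinders" "\<And>k. S \<subseteq> (\<Union>i. B k i)"
      "\<And>k. (\<Sum>i. emeasure coin (B k i)) \<le> ennreal ((1/2)^k)"
    by metis
  define C where "C i = (case prod_decode i of (k, j) \<Rightarrow> B k j)" for i
  have C: "C i \<in> cylinders" for i
    using B(1) by (auto simp: C_def split: prod.split)
  note Cs [simp] = sets_cylinders[OF C]
  have inf: "\<exists>i\<ge>m. z \<in> C i" if z: "z \<in> S" for z m
  proof -
    obtain j where "z \<in> B m j" using B(2)[of m] z by blast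
    then show ?thesis
      by (intro exI[of _ "prod_encode (m, j)"]) (simp add: C_def le_prod_encode_1)
  qed
  have "(\<Sum>i. emeasure coin (C i)) = (\<Sum>k. \<Sum>j. emeasure coin (B k j))"
    using suminf_ennreal_2dimen[of "\<lambda>k. \<Sum>j. emeasure coin (B k j)" "\<lambda>(k, j). emeasure coin (B k j)"]
    by (simp add: C_def split_beta)
  also have "\<dots> \<le> (\<Sum>k. ennreal ((1/2)^k))"
    by (intro suminf_le B(3) summableI)
  also have "\<dots> = ennreal (\<Sum>k. (1/2)^k)"
    by (rule suminf_ennreal2) (auto intro: summable_geometric)
  finally have "(\<Sum>i. ennreal (measure coin (C i))) \<noteq> top_class.top"
    by (auto simp: top_unique coin.emeasure_eq_measure)
  then have sm: "summable (\<lambda>i. measure coin (C i))"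
    by (intro summable_suminf_not_top) simp_all
  have "\<exists>M. \<forall>m\<ge>M. norm (\<Sum>i. measure coin (C (i + m))) < (1/8)^n" for n :: nat
    by (rule suminf_exist_split[OF _ sm]) simp
  then obtain M where M: "\<And>n m. m \<ge> M n \<Longrightarrow> norm (\<Sum>i. measure coin (C (i + m))) < (1/8)^n"
    by metis
  define N where "N n = (\<Sum>k\<le>n. Suc (M k))" for n
  have N: "strict_mono N" by (rule strict_monoI_Suc) (simp add: N_def)
  have MN: "M n \<le> N n" for n
    unfolding N_def using member_le_sum[of n "{..n}" "\<lambda>k. Suc (M k)"] by simp
  define V where "V n = (\<Union>i\<in>{N n..<N (Suc n)}. C i)" for n
  show ?thesis
  proof (rule that[of V])
    show "V n \<in> cylinders" for n
      unfolding V_def using C by (intro finite_UN_cylinders) auto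
    show "measure coin (V n) \<le> (1/8) ^ n" for n
    proof -
      have "x \<in> (\<Union>i. C (i + N n))" if x: "x \<in> V n" for x
      proof -
        obtain j where "x \<in> C j" "j \<ge> N n" using x unfolding V_def by auto
        then have "x \<in> C (j - N n + N n)" by simp
        then show ?thesis by blast
      qed
      then have "measure coin (V n) \<le> measure coin (\<Union>i. C (i + N n))"
        by (intro coin.finite_measure_mono) auto
      also have "\<dots> \<le> (\<Sum>i. measure coin (C (i + N n)))"
        using summable_ignore_initial_segment[OF sm] by (intro coin.finite_measure_subadditive_countably) auto
      finally show ?thesis using M[OF MN[of n]] by simp
    qed
    show "\<exists>n\<ge>n\<^sub>0. z \<in> V n" if z: "z \<in> S" for z n\<^sub>0
    proof -
      obtain i where i: "i \<ge> N n\<^sub>0" "z \<in> C i" using inf[OF z] by blast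
      then obtain n where "n \<ge> n\<^sub>0" "N n \<le> i" "i < N (Suc n)"
        using strict_mono_block[OF N] by metis
      with i show ?thesis unfolding V_def by (meson UN_I atLeastLessThan_iff)
    qed
  qed
qed

text \<open>Reading off coordinates through \<open>\<rho>\<close> produces independent fair coins except where \<open>\<rho>\<close> repeats
  an index. Repetitions confined to \<open>J\<^sub>0\<close> cost at most one factor 2 for each element of \<open>J\<^sub>0\<close>.\<close>

lemma
  fixes \<rho> :: "'i \<Rightarrow> 'j"
  assumes J: "finite J" and V: "depends_on J V" and J0: "J\<^sub>0 \<subseteq> J" and inj: "inj_on \<rho> (J - J\<^sub>0)"
  shows sets_reindex: "{\<omega>. (\<lambda>j. \<omega> (\<rho> j)) \<in> V} \<in> sets coin"
    and measure_reindex_le: "measure coin {\<omega>. (\<lambda>j. \<omega> (\<rho> j)) \<in> V} \<le> 2 ^ card J\<^sub>0 * measure coin V"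
proof -
  let ?R = "{\<omega>. (\<lambda>j. \<omega> (\<rho> j)) \<in> V}"
  have dep: "depends_on (\<rho> ` J) ?R"
    by (rule depends_onI) (simp, rule depends_onD[OF V], simp)
  show R: "?R \<in> sets coin"
    by (rule sets_depends_on[OF _ dep]) (use J in simp)
  let ?S = "{v\<in>V. \<forall>i. i \<notin> J \<longrightarrow> \<not> v i}"
  let ?L = "J - J\<^sub>0"
  have fin: "finite ?S"
    by (rule finite_subset[OF _ finite_supported_on(1)[OF J]]) auto
  have finJ1: "finite (\<rho> ` ?L)" using J by simp
  let ?c = "\<lambda>v. cyl (\<rho> ` ?L) (\<lambda>i. v (the_inv_into ?L \<rho> i))"
  have "?R \<subseteq> (\<Union>v\<in>?S. ?c v)"
  proof
    fix \<omega> assume "\<omega> \<in> ?R"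
    then have "(\<lambda>j. \<omega> (\<rho> j)) \<in> (\<Union>v\<in>?S. cyl J v)"
      using depends_on_eq_UN_cyl[OF V] by blast
    then obtain v where v: "v \<in> ?S" "\<And>j. j \<in> J \<Longrightarrow> \<omega> (\<rho> j) = v j"
      by (auto simp: cyl_def)
    have "\<omega> \<in> ?c v"
      using v(2) by (auto simp: cyl_def the_inv_into_f_f[OF inj])
    with v(1) show "\<omega> \<in> (\<Union>v\<in>?S. ?c v)" by blast
  qed
  then have "measure coin ?R \<le> measure coin (\<Union>v\<in>?S. ?c v)"
    by (intro coin.finite_measure_mono sets.finite_UN fin sets_cyl finJ1)
  also have "\<dots> \<le> (\<Sum>v\<in>?S. measure coin (?c v))"
    by (intro measure_UNION_le fin sets_cyl finJ1)
  also have "\<dots> = card ?S * (1/2) ^ card ?L"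
    by (simp add: measure_cyl[OF finJ1] card_image[OF inj])
  also have "\<dots> = 2 ^ card J\<^sub>0 * measure coin V"
  proof -
    have "card J = card ?L + card J\<^sub>0"
      using J J0 card_Diff_subset[of J\<^sub>0 J] card_mono[OF J J0] finite_subset[OF J0 J] by simp
    then have "(1/2) ^ card ?L = (2::real) ^ card J\<^sub>0 * (1/2) ^ card J"
      by (simp add: power_add power_one_over field_simps)
    then show ?thesis by (simp add: measure_depends_on[OF J V])
  qed
  finally show "measure coin ?R \<le> 2 ^ card J\<^sub>0 * measure coin V" .
qed

section \<open>Perfect sets avoiding a null set\<close>

definition pair_seq :: "(nat \<Rightarrow> bool) \<Rightarrow> (nat \<Rightarrow> bool) \<Rightarrow> bool \<times> nat \<Rightarrow> bool"
  where "pair_seq x y = (\<lambda>(b, p). if b then y p else x p)"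

lemma cylinders_bounded:
  fixes V :: "(bool \<times> nat \<Rightarrow> bool) set"
  assumes "V \<in> cylinders"
  obtains m where "depends_on (UNIV \<times> {..<m}) V"
proof -
  obtain J where J: "finite J" "depends_on J V" using assms by (auto simp: cylinders_def)
  then obtain m where "\<forall>p\<in>snd ` J. p < m"
    using finite_nat_set_iff_bounded[of "snd ` J"] by auto
  then have "J \<subseteq> UNIV \<times> {..<m}" by force
  then show ?thesis using that depends_on_mono J(2) by metis
qed

text \<open>The measure version of Mycielski's theorem: a null relation on the Cantor space has a Cantor set
  of pairwise unrelated points. The Cantor set is the body of a random tree. The bit of \<open>\<Psi> x\<close> at
  position \<open>p\<close> is a fresh coin attached to \<open>p\<close> and to the first \<open>d p\<close> bits of \<open>x\<close>, where \<open>d\<close>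
  tends to infinity so slowly that only \<open>4 ^ n\<close> pairs of branches are visible to the \<open>n\<close>-th
  cylinder \<open>V n\<close>, whose measure is at most \<open>(1/8) ^ n\<close>. Two branches that differ at \<open>k\<close> become
  independent after position \<open>l k\<close>, so some such pair falls into \<open>V n\<close> with probability at most
  \<open>2 ^ l k * (1/2) ^ n\<close>. By the Borel--Cantelli lemma almost every tree keeps each of its pairs
  out of all but finitely many \<open>V n\<close>, whereas related points lie in infinitely many.\<close>

lemma perfect_set_avoiding_null:
  fixes S :: "(bool \<times> nat \<Rightarrow> bool) set"
  assumes "S \<in> null_sets coin"
  obtains \<Psi> :: "(nat \<Rightarrow> bool) \<Rightarrow> nat \<Rightarrow> bool"
  where "\<And>p. \<exists>n. \<forall>x y. (\<forall>i<n. x i = y i) \<longrightarrow> \<Psi> x p = \<Psi> y p"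
    and "\<And>x y. x \<noteq> y \<Longrightarrow> pair_seq (\<Psi> x) (\<Psi> y) \<notin> S"
proof -
  obtain V where V: "\<And>n. V n \<in> cylinders" "\<And>n. measure coin (V n) \<le> (1/8) ^ n"
    and SV: "\<And>z n\<^sub>0. z \<in> S \<Longrightarrow> \<exists>n\<ge>n\<^sub>0. z \<in> V n"
    using null_subset_limsup_cylinders[OF assms] by metis
  have "\<exists>m. depends_on (UNIV \<times> {..<m}) (V n)" for n
    using cylinders_bounded[OF V(1)] by blast
  then obtain m where m: "\<And>n. depends_on (UNIV \<times> {..<m n}) (V n)"
    by metis
  \<comment> \<open>the bound \<open>m n\<close> on the coordinates seen by \<open>V n\<close>, enlarged to be strictly increasing\<close>
  define l where "l n = (\<Sum>k\<le>n. Suc (m k))" for n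
  have l: "strict_mono l" by (rule strict_monoI_Suc) (simp add: l_def)
  have ml: "m n \<le> l n" for n
    unfolding l_def using member_le_sum[of n "{..n}" "\<lambda>k. Suc (m k)"] by simp
  have dep: "depends_on (UNIV \<times> {..<l n}) (V n)" for n
    by (rule depends_on_mono[OF m[of n]]) (use ml[of n] in auto)
  define d where "d p = card {n. l n \<le> p}" for p
  note finl = finite_strict_mono_le[OF l]
  have d_le: "d p \<le> n" if "p < l n" for p n
  proof -
    have "m < n" if "l m \<le> p" for m
      using that \<open>p < l n\<close> strict_mono_less[OF l, of m n] by simp
    then have "{n. l n \<le> p} \<subseteq> {..<n}" by blast
    then have "d p \<le> card {..<n}" unfolding d_def by (intro card_mono) simp_all
    then show ?thesis by simp
  qed
  have d_gt: "k < d p" if "l k \<le> p" for p k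
  proof -
    have "{..k} \<subseteq> {n. l n \<le> p}"
      using that strict_mono_less_eq[OF l] le_trans by blast
    then have "card {..k} \<le> d p" unfolding d_def by (rule card_mono[OF finl])
    then show ?thesis by simp
  qed
  define \<Psi> where "\<Psi> \<omega> x p = \<omega> (p, map x [0..<d p])" for \<omega> :: "nat \<times> bool list \<Rightarrow> bool" and x p
  define \<rho> where "\<rho> x y = (\<lambda>(b, p). (p, map (if b then y else x) [0..<d p]))"
    for x y :: "nat \<Rightarrow> bool"
  have pair: "pair_seq (\<Psi> \<omega> x) (\<Psi> \<omega> y) = (\<lambda>j. \<omega> (\<rho> x y j))" for \<omega> x y
    by (rule ext) (simp add: pair_seq_def \<Psi>_def \<rho>_def split: prod.split)
  \<comment> \<open>infinite branches truncated to their first \<open>n\<close> bits, the only ones seen by \<open>V n\<close>\<close>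
  define T where "T n = {v :: nat \<Rightarrow> bool. \<forall>i. i \<notin> {..<n} \<longrightarrow> \<not> v i}" for n
  have finT: "finite (T n)" and cardT: "card (T n) = 2 ^ n" for n
    using finite_supported_on[of "{..<n}"] by (simp_all add: T_def)
  define P where "P k n = {(x, y) \<in> T n \<times> T n. x k \<noteq> y k}" for k n
  have finP: "finite (P k n)" for k n
    by (rule finite_subset[of _ "T n \<times> T n"]) (auto simp: P_def finT)
  have cardP: "card (P k n) \<le> 4 ^ n" for k n
  proof -
    have "card (P k n) \<le> card (T n \<times> T n)"
      by (rule card_mono) (auto simp: P_def finT)
    also have "\<dots> = 4 ^ n" by (simp add: card_cartesian_product cardT flip: power_mult_distrib)
    finally show ?thesis .
  qed
  define B where "B k n = (\<Union>(x, y)\<in>P k n. {\<omega>. (\<lambda>j. \<omega> (\<rho> x y j)) \<in> V n})" for k n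
  have pr: "{\<omega>. (\<lambda>j. \<omega> (\<rho> x y j)) \<in> V n} \<in> sets coin"
    "measure coin {\<omega>. (\<lambda>j. \<omega> (\<rho> x y j)) \<in> V n} \<le> 2 ^ l k * (1/8) ^ n"
    if xy: "(x, y) \<in> P k n" for x y k n
  proof -
    have "x k \<noteq> y k" using xy by (simp add: P_def)
    let ?J = "UNIV \<times> {..<l n} :: (bool \<times> nat) set"
    \<comment> \<open>before position \<open>l k\<close> the two branches may share coins, so the second copy is discarded there\<close>
    let ?K = "?J \<inter> {True} \<times> {..<l k}"
    have eq: "b = b'" if "(b, p) \<in> ?J - ?K" "(b', p) \<in> ?J - ?K" "\<rho> x y (b, p) = \<rho> x y (b', p)" for b b' p
    proof (rule ccontr)
      assume "b \<noteq> b'"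
      then have "l k \<le> p" using that by (cases b; cases b') auto
      then have "k < d p" by (rule d_gt)
      moreover have "map x [0..<d p] = map y [0..<d p]"
        using that(3) \<open>b \<noteq> b'\<close> by (cases b; cases b') (auto simp: \<rho>_def)
      ultimately have "x k = y k" by (simp add: list_eq_iff_nth_eq)
      then show False using \<open>x k \<noteq> y k\<close> by simp
    qed
    have inj: "inj_on (\<rho> x y) (?J - ?K)"
    proof (rule inj_onI)
      fix u v assume uv: "u \<in> ?J - ?K" "v \<in> ?J - ?K" "\<rho> x y u = \<rho> x y v"
      obtain b p b' p' where bp: "u = (b, p)" "v = (b', p')" by (cases u, cases v)
      have "p = p'" using uv(3) by (simp add: \<rho>_def bp)
      with uv eq[of b p b'] show "u = v" unfolding bp by blast
    qed
    have "card ?K \<le> card ({True} \<times> {..<l k})" by (rule card_mono) auto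
    then have c: "card ?K \<le> l k" by (simp add: card_cartesian_product)
    show "{\<omega>. (\<lambda>j. \<omega> (\<rho> x y j)) \<in> V n} \<in> sets coin"
      by (rule sets_reindex[OF _ dep _ inj]) auto
    have "measure coin {\<omega>. (\<lambda>j. \<omega> (\<rho> x y j)) \<in> V n} \<le> 2 ^ card ?K * measure coin (V n)"
      by (rule measure_reindex_le[OF _ dep _ inj]) auto
    also have "\<dots> \<le> 2 ^ l k * (1/8) ^ n"
      by (intro mult_mono V(2) power_increasing c) auto
    finally show "measure coin {\<omega>. (\<lambda>j. \<omega> (\<rho> x y j)) \<in> V n} \<le> 2 ^ l k * (1/8) ^ n" .
  qed
  have Bs: "B k n \<in> sets coin" for k n
    unfolding B_def by (rule sets.finite_UN[OF finP]) (use pr(1) in auto)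
  have B_le: "measure coin (B k n) \<le> 2 ^ l k * (1/2) ^ n" for k n
  proof -
    have "measure coin (B k n) \<le> (\<Sum>(x, y)\<in>P k n. measure coin {\<omega>. (\<lambda>j. \<omega> (\<rho> x y j)) \<in> V n})"
      unfolding B_def split_beta
      by (rule measure_UNION_le[OF finP]) (use pr(1) in auto)
    also have "\<dots> \<le> (\<Sum>(x, y)\<in>P k n. 2 ^ l k * (1/8) ^ n)"
      by (rule sum_mono) (use pr(2) in auto)
    also have "\<dots> = real (card (P k n)) * (2 ^ l k * (1/8) ^ n)" by (simp add: split_beta)
    also have "\<dots> \<le> 4 ^ n * (2 ^ l k * (1/8) ^ n)"
      by (rule mult_right_mono) (use cardP[of k n] of_nat_mono in \<open>fastforce+\<close>)
    also have "\<dots> = 2 ^ l k * (4 * (1/8)) ^ n" by (simp only: power_mult_distrib mult_ac)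
    finally show ?thesis by simp
  qed
  have "AE \<omega> in coin. eventually (\<lambda>n. \<omega> \<in> space coin - B k n) sequentially" for k
  proof (rule borel_cantelli_AE1)
    show "summable (\<lambda>n. measure coin (B k n))"
      by (rule summable_comparison_test'[of "\<lambda>n. 2 ^ l k * (1/2) ^ n" 0])
         (use B_le in \<open>auto intro!: summable_mult summable_geometric\<close>)
  qed (use Bs in \<open>auto simp: less_top[symmetric]\<close>)
  then have "AE \<omega> in coin. \<forall>k. eventually (\<lambda>n. \<omega> \<notin> B k n) sequentially"
    by (simp add: AE_all_countable)
  then obtain \<omega> where \<omega>: "\<And>k. eventually (\<lambda>n. \<omega> \<notin> B k n) sequentially"
    using eventually_happens'[OF coin.ae_filter_bot] by blast
  show ?thesis
  proof (rule that[of "\<Psi> \<omega>"])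
    show "\<exists>n. \<forall>x y. (\<forall>i<n. x i = y i) \<longrightarrow> \<Psi> \<omega> x p = \<Psi> \<omega> y p" for p
      by (rule exI[of _ "d p"]) (auto simp: \<Psi>_def intro!: arg_cong[where f = \<omega>])
    fix x y :: "nat \<Rightarrow> bool" assume "x \<noteq> y"
    then obtain k where k: "x k \<noteq> y k" by blast
    obtain n\<^sub>0 where n0: "\<And>n. n \<ge> n\<^sub>0 \<Longrightarrow> \<omega> \<notin> B k n"
      using \<omega>[of k] by (auto simp: eventually_sequentially)
    show "pair_seq (\<Psi> \<omega> x) (\<Psi> \<omega> y) \<notin> S"
    proof
      assume "pair_seq (\<Psi> \<omega> x) (\<Psi> \<omega> y) \<in> S"
      then obtain n where n: "n \<ge> max n\<^sub>0 (Suc k)" "(\<lambda>j. \<omega> (\<rho> x y j)) \<in> V n"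
        using SV[of _ "max n\<^sub>0 (Suc k)"] unfolding pair by blast
      let ?x = "\<lambda>i. i < n \<and> x i" and ?y = "\<lambda>i. i < n \<and> y i"
      have "(?x, ?y) \<in> P k n" using k n(1) by (auto simp: P_def T_def)
      moreover have "\<rho> ?x ?y j = \<rho> x y j" if "j \<in> UNIV \<times> {..<l n}" for j
        using that d_le[of "snd j" n] by (auto simp: \<rho>_def)
      then have "(\<lambda>j. \<omega> (\<rho> ?x ?y j)) \<in> V n"
        using n(2) depends_onD[OF dep[of n], of "\<lambda>j. \<omega> (\<rho> ?x ?y j)" "\<lambda>j. \<omega> (\<rho> x y j)"] by simp
      ultimately have "\<omega> \<in> B k n" unfolding B_def by blast
      with n0 n(1) show False by auto
    qed
  qed
qed

section \<open>The topology of the binary cube\<close>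

definition cantor :: "('i \<Rightarrow> bool) topology"
  where "cantor = product_topology (\<lambda>_. discrete_topology UNIV) UNIV"

lemma topspace_cantor [simp]: "topspace cantor = UNIV"
  by (simp add: cantor_def)

lemma compact_space_cantor: "compact_space cantor"
  by (simp add: cantor_def compact_space_product_topology compact_space_discrete_topology)

lemma openin_cantor_iff: "openin cantor U \<longleftrightarrow> (\<forall>x\<in>U. \<exists>J. finite J \<and> cyl J x \<subseteq> U)"
proof -
  have cyl: "Pi\<^sub>E UNIV (\<lambda>i. if i \<in> J then {x i} else UNIV) = cyl J x" for J and x :: "'a \<Rightarrow> bool"
    by (auto simp: cyl_def PiE_iff split: if_splits)
  show ?thesis
  proof (intro iffI ballI)
    fix x assume U: "openin cantor U" "x \<in> U"
    then obtain W where W: "finite {i. W i \<noteq> UNIV}" "x \<in> Pi\<^sub>E UNIV W" "Pi\<^sub>E UNIV W \<subseteq> U"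
      unfolding cantor_def openin_product_topology_alt by fastforce
    have "cyl {i. W i \<noteq> UNIV} x \<subseteq> Pi\<^sub>E UNIV W"
    proof
      fix z assume z: "z \<in> cyl {i. W i \<noteq> UNIV} x"
      have "z i \<in> W i" for i
        using z W(2) by (cases "W i = UNIV") (auto simp: cyl_def PiE_iff)
      then show "z \<in> Pi\<^sub>E UNIV W" by (simp add: PiE_iff)
    qed
    then have "cyl {i. W i \<noteq> UNIV} x \<subseteq> U" using W(3) by (rule subset_trans)
    with W(1) show "\<exists>J. finite J \<and> cyl J x \<subseteq> U" by blast
  next
    assume *: "\<forall>x\<in>U. \<exists>J. finite J \<and> cyl J x \<subseteq> U"
    have "\<exists>W. finite {i. W i \<noteq> UNIV} \<and> x \<in> Pi\<^sub>E UNIV W \<and> Pi\<^sub>E UNIV W \<subseteq> U" if x: "x \<in> U" for x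
    proof -
      obtain J where J: "finite J" "cyl J x \<subseteq> U" using bspec[OF * x] by blast
      have "finite {i. (if i \<in> J then {x i} else UNIV) \<noteq> UNIV}"
        by (rule finite_subset[OF _ J(1)]) auto
      with J(2) cyl[of J x] show ?thesis
        by (intro exI[of _ "\<lambda>i. if i \<in> J then {x i} else UNIV"]) (auto simp: cyl_def)
    qed
    then show "openin cantor U"
      unfolding cantor_def openin_product_topology_alt by simp
  qed
qed

lemma openin_cantor_measurable:
  fixes U :: "('i::countable \<Rightarrow> bool) set"
  assumes "openin cantor U"
  shows "U \<in> sets coin"
proof -
  let ?A = "\<lambda>J. {x. cyl J x \<subseteq> U}"
  have dep: "depends_on J (?A J)" for J
  proof (rule depends_onI)
    fix z w :: "'i \<Rightarrow> bool" assume "\<And>i. i \<in> J \<Longrightarrow> z i = w i"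
    then have "cyl J z = cyl J w" by (simp add: cyl_def)
    then show "z \<in> ?A J \<longleftrightarrow> w \<in> ?A J" by simp
  qed
  have "U = (\<Union>J\<in>Collect finite. ?A J)"
  proof (intro equalityI subsetI)
    show "x \<in> (\<Union>J\<in>Collect finite. ?A J)" if "x \<in> U" for x
      using assms that by (auto simp: openin_cantor_iff)
    show "x \<in> U" if x: "x \<in> (\<Union>J\<in>Collect finite. ?A J)" for x
    proof -
      obtain J where "cyl J x \<subseteq> U" using x by blast
      moreover have "x \<in> cyl J x" by (simp add: cyl_def)
      ultimately show ?thesis by blast
    qed
  qed
  also have "\<dots> \<in> sets coin"
    by (rule sets.countable_UN'[OF countable_Collect_finite]) (auto intro: sets_depends_on dep)
  finally show ?thesis .
qed

lemma continuous_map_cantor_into_cantor: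
  fixes f :: "('i \<Rightarrow> bool) \<Rightarrow> 'j \<Rightarrow> bool"
  assumes "\<And>j. \<exists>J. finite J \<and> (\<forall>x y. (\<forall>i\<in>J. x i = y i) \<longrightarrow> f x j = f y j)"
  shows "continuous_map cantor cantor f"
proof -
  have "continuous_map cantor (discrete_topology UNIV) (\<lambda>x. f x j)" for j
  proof -
    obtain J where J: "finite J" "\<And>x y. (\<forall>i\<in>J. x i = y i) \<Longrightarrow> f x j = f y j"
      using assms by blast
    have "openin cantor {x. f x j \<in> U}" for U
      unfolding openin_cantor_iff
    proof
      fix x assume x: "x \<in> {x. f x j \<in> U}"
      have "cyl J x \<subseteq> {x. f x j \<in> U}"
      proof
        fix y assume "y \<in> cyl J x"
        then have "f y j = f x j" by (intro J(2)) (simp add: cyl_def)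
        with x show "y \<in> {x. f x j \<in> U}" by simp
      qed
      with J(1) show "\<exists>J. finite J \<and> cyl J x \<subseteq> {x. f x j \<in> U}" by blast
    qed
    then show ?thesis by (simp add: continuous_map_def)
  qed
  then show ?thesis
    unfolding cantor_def by (simp add: continuous_map_componentwise_UNIV)
qed

section \<open>Polish groups and pulled-back measurability\<close>

context polish_group
begin

lemma openin_subset_carrier: "openin T U \<Longrightarrow> U \<subseteq> carrier G"
  using openin_subset topspace_eq_carrier by blast

lemma continuous_map_mult:
  assumes "continuous_map X T f" "continuous_map X T g"
  shows "continuous_map X T (\<lambda>x. f x \<otimes> g x)"
proof -
  have "continuous_map X (prod_topology T T) (\<lambda>x. (f x, g x))"
    using assms by (simp add: continuous_map_pairedI)
  from continuous_map_compose[OF this continuous_mult] show ?thesis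
    by (simp add: o_def)
qed

lemma continuous_map_inverse:
  "continuous_map X T f \<Longrightarrow> continuous_map X T (\<lambda>x. inv f x)"
  using continuous_map_compose[OF _ continuous_inv, of X f] by (simp add: o_def)

lemma continuous_map_const_carrier: "a \<in> carrier G \<Longrightarrow> continuous_map X T (\<lambda>_. a)"
  using topspace_eq_carrier by simp

lemma openin_preimage:
  assumes "continuous_map T T f" "openin T U"
  shows "openin T {x \<in> carrier G. f x \<in> U}"
  using openin_continuous_map_preimage[OF assms] topspace_eq_carrier by simp

lemmas continuous_map_group_intros =
  continuous_map_mult continuous_map_inverse continuous_map_const_carrier continuous_map_id[unfolded id_def]

lemma nbhd_binary:
  assumes f: "continuous_map (prod_topology T T) T (\<lambda>(x, y). f x y)" and "f \<one> \<one> = \<one>"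
    and W: "openin T W" "\<one> \<in> W"
  obtains V where "openin T V" "\<one> \<in> V" "\<And>x y. x \<in> V \<Longrightarrow> y \<in> V \<Longrightarrow> f x y \<in> W"
proof -
  define S where "S = {z \<in> topspace (prod_topology T T). (case z of (x, y) \<Rightarrow> f x y) \<in> W}"
  have o: "openin (prod_topology T T) S"
    unfolding S_def by (rule openin_continuous_map_preimage[OF f W(1)])
  have "(\<one>, \<one>) \<in> S"
    using assms topspace_eq_carrier by (simp add: S_def)
  from openin_prod_topology_alt[THEN iffD1, OF o, rule_format, OF this]
  obtain A B where AB: "openin T A" "openin T B" "\<one> \<in> A" "\<one> \<in> B" "A \<times> B \<subseteq> S"
    by blast
  show ?thesis
  proof (rule that)
    show "openin T (A \<inter> B)" "\<one> \<in> A \<inter> B" using AB by auto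
    show "f x y \<in> W" if "x \<in> A \<inter> B" "y \<in> A \<inter> B" for x y
      using AB(5) that by (auto simp: S_def)
  qed
qed

lemma nbhd_mult:
  assumes "openin T W" "\<one> \<in> W"
  obtains V where "openin T V" "\<one> \<in> V" "\<And>x y. x \<in> V \<Longrightarrow> y \<in> V \<Longrightarrow> x \<otimes> y \<in> W"
  using nbhd_binary[of "\<lambda>x y. x \<otimes> y" W thesis] assms continuous_mult by auto

lemma nbhd_div:
  assumes "openin T W" "\<one> \<in> W"
  obtains V where "openin T V" "\<one> \<in> V" "\<And>x y. x \<in> V \<Longrightarrow> y \<in> V \<Longrightarrow> inv x \<otimes> y \<in> W"
proof -
  have c: "continuous_map (prod_topology T T) T (\<lambda>(x, y). inv x \<otimes> y)"
    unfolding split_beta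
    by (intro continuous_map_mult continuous_map_inverse continuous_map_fst continuous_map_snd)
  show thesis
    by (rule nbhd_binary[OF c _ assms]) (simp, rule that)
qed

text \<open>All that is used of universal measurability: pulling a set back along a continuous map from
  the binary cube gives a set measurable for the completed coin measure. In this form the property
  passes at once to conjugates and to finite intersections. The index type makes room for two
  points of the Cantor space at once, because the sets to be measured are relations.\<close>

definition coin_measurable :: "'a set \<Rightarrow> bool"
  where "coin_measurable A \<longleftrightarrow>
    (\<forall>\<Theta> :: (bool \<times> nat \<Rightarrow> bool) \<Rightarrow> 'a. continuous_map cantor T \<Theta> \<longrightarrow> \<Theta> -` A \<in> sets (completion coin))"

text \<open>Universal measurability is applied to the image of the coin measure.\<close>

lemma universally_measurable_imp_coin_measurable:
  assumes A: "universally_measurable T A"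
  shows "coin_measurable A"
  unfolding coin_measurable_def
proof (intro allI impI)
  fix \<Theta> :: "(bool \<times> nat \<Rightarrow> bool) \<Rightarrow> 'a"
  assume \<Theta>: "continuous_map cantor T \<Theta>"
  define B where "B = sigma (topspace T) {U. openin T U}"
  have sub: "{U. openin T U} \<subseteq> Pow (topspace T)" using openin_subset by auto
  have B: "space B = topspace T" "sets B = borel_sets_of T"
    using sub by (simp_all add: B_def borel_sets_of_def)
  have range: "\<Theta> z \<in> topspace T" for z
    using continuous_map_image_subset_topspace[OF \<Theta>] by auto
  have meas: "\<Theta> \<in> coin \<rightarrow>\<^sub>M B"
  proof (rule measurable_sigma_sets[OF _ sub])
    show "sets B = sigma_sets (topspace T) {U. openin T U}"
      using B(2) by (simp add: borel_sets_of_def)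
    fix U assume "U \<in> {U. openin T U}"
    then have "openin cantor {z \<in> topspace cantor. \<Theta> z \<in> U}"
      using openin_continuous_map_preimage[OF \<Theta>] by blast
    from openin_cantor_measurable[OF this] show "\<Theta> -` U \<inter> space coin \<in> sets coin"
      by (simp add: vimage_def)
  qed (use range in auto)
  let ?\<nu> = "distr coin B \<Theta>"
  have "borel_prob_measure T ?\<nu>"
    unfolding borel_prob_measure_def using B coin.prob_space_distr[OF meas] by simp
  then obtain C where C: "C \<in> borel_sets_of T" "sym_diff A C \<in> null_sets (completion ?\<nu>)"
    using A unfolding universally_measurable_def by blast
  then obtain N where N: "N \<in> null_sets ?\<nu>" "sym_diff A C \<subseteq> N"
    unfolding null_sets_completion_iff2 by blast
  have "\<Theta> -` N \<in> null_sets coin"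
    using N(1) null_sets_distr_iff[OF meas] by simp
  moreover have "sym_diff (\<Theta> -` A) (\<Theta> -` C) \<subseteq> \<Theta> -` N"
    using N(2) by blast
  moreover have "\<Theta> -` C \<in> sets coin"
    using measurable_sets[OF meas, of C] C(1) B by simp
  ultimately show "\<Theta> -` A \<in> sets (completion coin)"
    by (intro sets_completionI[of _ "\<Theta> -` C - \<Theta> -` N" "\<Theta> -` A \<inter> \<Theta> -` N" "\<Theta> -` N"]) auto
qed

section \<open>Infinite products and inequivalent points\<close>

text \<open>The \<open>g n\<close> are chosen so close to the identity that right multiplication by \<open>g n\<close> moves each of
  the finitely many earlier partial products by less than \<open>(1/2) ^ n\<close>. The products
  \<open>g 0 ^ x 0 * g 1 ^ x 1 * ...\<close> then converge uniformly in \<open>x\<close>, even though the metric is not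
  assumed to be invariant. Switching on the \<open>n\<close>-th factor multiplies the limit on the left by
  \<open>a * g n * inv a\<close> with \<open>a\<close> the product of the factors before it. Only finitely many \<open>a\<close> occur,
  so it is enough that \<open>g n\<close> avoids finitely many conjugates of \<open>F\<close>. All choices are made
  inside \<open>H\<close>, which will be the whole group or an open subgroup.\<close>

lemma convergent_products:
  assumes H: "\<one> \<in> H" "H \<subseteq> carrier G" "\<And>a g. a \<in> H \<Longrightarrow> g \<in> H \<Longrightarrow> a \<otimes> g \<in> H"
    and avoid: "\<And>A W. finite A \<Longrightarrow> A \<subseteq> H \<Longrightarrow> openin T W \<Longrightarrow> \<one> \<in> W \<Longrightarrow>
      \<exists>g\<in>W \<inter> H. \<forall>a\<in>A. a \<otimes> g \<otimes> inv a \<notin> F"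
  obtains \<phi> :: "(nat \<Rightarrow> bool) \<Rightarrow> 'a"
  where "continuous_map cantor T \<phi>"
    and "\<And>n x. \<not> x n \<Longrightarrow> \<phi> (flip n x) \<otimes> inv (\<phi> x) \<notin> F"
proof -
  obtain M d where md: "Metric_space M d" "Metric_space.mcomplete M d" "T = Metric_space.mtopology M d"
    using polish unfolding polish_topology_def completely_metrizable_space_def by auto
  interpret m: Metric_space M d by (rule md(1))
  have M: "M = carrier G"
    using topspace_eq_carrier md(3) by simp
  \<comment> \<open>\<open>A\<close> collects the partial products of the factors before the \<open>n\<close>-th factor \<open>g\<close>\<close>
  define P where "P n = (\<lambda>(A, g). finite A \<and> A \<subseteq> H \<and> \<one> \<in> A \<and> g \<in> H \<and>
    (\<forall>a\<in>A. d a (a \<otimes> g) < (1/2)^n \<and> a \<otimes> g \<otimes> inv a \<notin> F))" for n :: nat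
  have ex: "\<exists>g. P n (A, g)" if A: "finite A" "A \<subseteq> H" "\<one> \<in> A" for n A
  proof -
    let ?W = "\<Inter>a\<in>A. {x \<in> carrier G. a \<otimes> x \<in> m.mball a ((1/2)^n)}"
    have Ac: "A \<subseteq> carrier G" using A H by blast
    have "openin T ?W"
    proof (rule openin_INT2)
      show "openin T {x \<in> carrier G. a \<otimes> x \<in> m.mball a ((1/2)^n)}" if "a \<in> A" for a
        using that Ac md(3) by (intro openin_preimage continuous_map_group_intros) auto
    qed (use A in auto)
    moreover have "\<one> \<in> {x \<in> carrier G. a \<otimes> x \<in> m.mball a ((1/2)^n)}" if "a \<in> A" for a
    proof -
      have a: "a \<in> carrier G" "a \<in> M" using that Ac M by auto
      from a(2) have "a \<in> m.mball a ((1/2)^n)" by simp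
      with a(1) show ?thesis by simp
    qed
    then have "\<one> \<in> ?W" by blast
    ultimately obtain g where "g \<in> ?W \<inter> H" "\<forall>a\<in>A. a \<otimes> g \<otimes> inv a \<notin> F"
      using avoid[OF A(1,2)] by blast
    then have "P n (A, g)" unfolding P_def using A by auto
    then show ?thesis ..
  qed
  have "\<exists>f. \<forall>n. P n (f n) \<and> fst (f (Suc n)) = fst (f n) \<union> (\<lambda>a. a \<otimes> snd (f n)) ` fst (f n)"
  proof (rule dependent_nat_choice)
    show "\<exists>x. P 0 x" using ex[of "{\<one>}" 0] H by auto
    fix x n assume x: "P n x"
    let ?A = "fst x \<union> (\<lambda>a. a \<otimes> snd x) ` fst x"
    have "\<exists>g. P (Suc n) (?A, g)"
      using x H(3) unfolding P_def by (intro ex[unfolded P_def]) (auto simp: split_beta)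
    then show "\<exists>y. P (Suc n) y \<and> fst y = ?A" by fastforce
  qed
  then obtain f where f: "\<And>n. P n (f n)"
    "\<And>n. fst (f (Suc n)) = fst (f n) \<union> (\<lambda>a. a \<otimes> snd (f n)) ` fst (f n)" by blast
  define A where "A n = fst (f n)" for n
  define g where "g n = snd (f n)" for n
  have AH: "A n \<subseteq> H" "\<one> \<in> A n" and g: "g n \<in> H"
    and Ad: "\<And>a. a \<in> A n \<Longrightarrow> d a (a \<otimes> g n) < (1/2)^n"
    and AF: "\<And>a. a \<in> A n \<Longrightarrow> a \<otimes> g n \<otimes> inv a \<notin> F"
    and A_Suc: "A (Suc n) = A n \<union> (\<lambda>a. a \<otimes> g n) ` A n" for n
    using f(1)[of n] f(2)[of n] unfolding A_def g_def P_def by (auto simp: split_beta)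
  define p where "p x = rec_nat \<one> (\<lambda>n r. if x n then r \<otimes> g n else r)" for x
  have p0: "p x 0 = \<one>" and pS: "p x (Suc n) = (if x n then p x n \<otimes> g n else p x n)" for x n
    by (simp_all add: p_def)
  have pA: "p x n \<in> A n" for x n
    by (induction n) (auto simp: p0 pS AH A_Suc)
  have pc: "p x n \<in> carrier G" for x n using pA AH H by blast
  have gc: "g n \<in> carrier G" for n using g H by blast
  have step: "d (p x n) (p x (Suc n)) \<le> (1/2)^n" for x n
    using Ad[OF pA[of x n]] pc[of x n] M by (auto simp: pS intro: less_imp_le)
  have dist: "d (p x n) (p x (n + k)) \<le> 2 * (1/2)^n - 2 * (1/2)^(n+k)" for x n k
  proof (induction k)
    case (Suc k)
    have "d (p x n) (p x (n + Suc k)) \<le> d (p x n) (p x (n + k)) + d (p x (n + k)) (p x (Suc (n + k)))"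
      using m.triangle[of "p x n" "p x (n + k)" "p x (n + Suc k)"] pc M by simp
    then show ?case using Suc step[of x "n + k"] by (simp add: power_add)
  qed (use pc M in simp)
  have dist': "d (p x n) (p x k) \<le> 2 * (1/2)^n" if "n \<le> k" for x n k
  proof -
    have "0 \<le> (1/2 :: real)^k" by simp
    then show ?thesis using dist[of x n "k - n"] that by (simp del: zero_le_power)
  qed
  have small: "\<exists>n. c * (1/2)^n < (e::real)" if "e > 0" "c > 0" for e c
    using real_arch_pow_inv[of "e / c" "1/2"] that by (auto simp: field_simps)
  have "\<exists>l. limitin T (p x) l sequentially" for x
  proof -
    have "m.MCauchy (p x)"
      unfolding m.MCauchy_def
    proof (intro conjI allI impI)
      show "range (p x) \<subseteq> M" using pc M by auto
      fix e :: real assume "e > 0"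
      then obtain N where N: "4 * (1/2)^N < e" using small[of e 4] by auto
      have "d (p x n) (p x n') < e" if "N \<le> n" "N \<le> n'" for n n'
      proof -
        have "d (p x n) (p x n') \<le> d (p x N) (p x n) + d (p x N) (p x n')"
          using m.triangle'[of "p x n" "p x N" "p x n'"] m.triangle[of "p x n" "p x N" "p x n'"]
            m.commute[of "p x n" "p x N"] pc M by simp
        then show ?thesis using dist'[OF that(1), of x] dist'[OF that(2), of x] N by simp
      qed
      then show "\<exists>N. \<forall>n n'. N \<le> n \<longrightarrow> N \<le> n' \<longrightarrow> d (p x n) (p x n') < e" by blast
    qed
    then show ?thesis using md(2,3) unfolding m.mcomplete_def by blast
  qed
  then obtain \<phi> where \<phi>: "\<And>x. limitin T (p x) (\<phi> x) sequentially" by metis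
  have \<phi>c: "\<phi> x \<in> carrier G" for x
    using limitin_topspace[OF \<phi>] topspace_eq_carrier by simp
  have d\<phi>: "d (p x n) (\<phi> x) \<le> 2 * (1/2)^n" for x n
  proof (rule field_le_epsilon)
    fix e :: real assume "e > 0"
    then have "\<forall>\<^sub>F k in sequentially. p x k \<in> M \<and> d (p x k) (\<phi> x) < e"
      using \<phi>[of x] unfolding md(3) m.limitin_metric by blast
    then have "\<forall>\<^sub>F k in sequentially. d (p x k) (\<phi> x) < e \<and> n \<le> k"
      using eventually_ge_at_top[of n] by eventually_elim simp
    then obtain k where k: "d (p x k) (\<phi> x) < e" "n \<le> k"
      using eventually_happens'[OF sequentially_bot] by blast
    have "d (p x n) (\<phi> x) \<le> d (p x n) (p x k) + d (p x k) (\<phi> x)"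
      using m.triangle pc \<phi>c M by simp
    then show "d (p x n) (\<phi> x) \<le> 2 * (1/2)^n + e" using dist'[OF k(2), of x] k(1) by simp
  qed
  have agree: "p y n = p x n" if "\<And>i. i < n \<Longrightarrow> y i = x i" for x y n
    using that by (induction n) (auto simp: p0 pS)
  have cont: "continuous_map cantor T \<phi>"
    unfolding continuous_map_def
  proof (intro conjI allI impI)
    show "\<phi> \<in> topspace cantor \<rightarrow> topspace T" using \<phi>c topspace_eq_carrier by simp
    fix U assume U: "openin T U"
    show "openin cantor {x \<in> topspace cantor. \<phi> x \<in> U}"
      unfolding openin_cantor_iff
    proof
      fix x assume "x \<in> {x \<in> topspace cantor. \<phi> x \<in> U}"
      then obtain r where r: "r > 0" "m.mball (\<phi> x) r \<subseteq> U"
        using U unfolding md(3) m.openin_mtopology by auto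
      obtain n where n: "4 * (1/2)^n < r" using small[of r 4] r by auto
      have "\<phi> y \<in> U" if y: "y \<in> cyl {..<n} x" for y
      proof -
        have eq: "p y n = p x n" using y by (intro agree) (simp add: cyl_def)
        have "d (\<phi> x) (\<phi> y) \<le> d (p x n) (\<phi> x) + d (p x n) (\<phi> y)"
          using m.triangle[of "\<phi> x" "p x n" "\<phi> y"] m.commute[of "\<phi> x" "p x n"] pc \<phi>c M by simp
        then have "d (\<phi> x) (\<phi> y) < r" using d\<phi>[of x n] d\<phi>[of y n] eq n by simp
        moreover have "\<phi> x \<in> M" "\<phi> y \<in> M" using \<phi>c M by simp_all
        ultimately have "\<phi> y \<in> m.mball (\<phi> x) r" by simp
        then show ?thesis using r(2) by blast
      qed
      then show "\<exists>J. finite J \<and> cyl J x \<subseteq> {x \<in> topspace cantor. \<phi> x \<in> U}"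
        by (intro exI[of _ "{..<n}"]) auto
    qed
  qed
  have "\<phi> (flip n x) \<otimes> inv (\<phi> x) \<notin> F" if x: "\<not> x n" for n x
  proof -
    define a where "a = p x n"
    define c where "c = a \<otimes> g n \<otimes> inv a"
    have ac: "a \<in> carrier G" "c \<in> carrier G" using pc gc by (auto simp: a_def c_def)
    define y where "y = flip n x"
    have y: "y n" "\<And>m. m \<noteq> n \<Longrightarrow> y m = x m" using x by (auto simp: y_def flip_def)
    have eq: "p y m = c \<otimes> p x m" if "m > n" for m
      using that
    proof (induction m)
      case (Suc m)
      show ?case
      proof (cases "m = n")
        case True
        have "p y n = a" unfolding a_def by (rule agree) (simp add: y)
        then show ?thesis
          using True x y(1) ac gc by (simp add: pS c_def a_def[symmetric] m_assoc)
      next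
        case False
        then have "p y m = c \<otimes> p x m" using Suc by simp
        then show ?thesis
          using False y(2) ac gc pc by (simp add: pS m_assoc)
      qed
    qed simp
    have "limitin T ((\<lambda>y. c \<otimes> y) \<circ> p x) (c \<otimes> \<phi> x) sequentially"
      by (rule continuous_map_limit[OF _ \<phi>]) (intro continuous_map_group_intros ac)
    moreover have "\<forall>\<^sub>F m in sequentially. ((\<lambda>y. c \<otimes> y) \<circ> p x) m = p y m"
      using eventually_gt_at_top[of n] by eventually_elim (simp add: eq)
    ultimately have "limitin T (p y) (c \<otimes> \<phi> x) sequentially"
      by (rule limitin_transform_eventually[rotated])
    then have "\<phi> (flip n x) = c \<otimes> \<phi> x"
      using \<phi>[of y] unfolding md(3) y_def[symmetric] by (meson m.limitin_metric_unique sequentially_bot)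
    then have "\<phi> (flip n x) \<otimes> inv (\<phi> x) = c"
      using ac \<phi>c by (simp add: m_assoc)
    then show ?thesis using AF[OF pA[of x n]] by (simp add: c_def a_def)
  qed
  with cont show ?thesis using that by blast
qed

text \<open>Call \<open>x\<close> and \<open>y\<close> equivalent if \<open>\<phi> x\<close> and \<open>\<phi> y\<close> lie in the same right coset of \<open>F\<close>. Changing
  one bit of \<open>y\<close> always changes its class, so the relation is disjoint from its own flips in the
  second argument and therefore null; a Cantor set of inequivalent points exists. Inversion turns
  right cosets into left cosets.\<close>

lemma cantor_transversal_if_flips_leave:
  fixes \<phi> :: "(nat \<Rightarrow> bool) \<Rightarrow> 'a"
  assumes F: "subgroup F G" and meas: "coin_measurable F"
    and \<phi>: "continuous_map cantor T \<phi>"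
    and flip: "\<And>n x. \<not> x n \<Longrightarrow> \<phi> (flip n x) \<otimes> inv (\<phi> x) \<notin> F"
  obtains f :: "(nat \<Rightarrow> bool) \<Rightarrow> 'a"
  where "continuous_map cantor T f" "\<And>x y. x \<noteq> y \<Longrightarrow> inv (f x) \<otimes> f y \<notin> F"
proof -
  interpret F: subgroup F G by fact
  have \<phi>c: "\<phi> x \<in> carrier G" for x
    using continuous_map_image_subset_topspace[OF \<phi>] topspace_eq_carrier by auto
  have sw: "b \<otimes> inv a \<in> F" if "a \<otimes> inv b \<in> F" "a \<in> carrier G" "b \<in> carrier G" for a b
    using F.m_inv_closed[OF that(1)] that by (simp add: inv_mult_group)
  have tr: "a \<otimes> inv c \<in> F" if "a \<otimes> inv b \<in> F" "b \<otimes> inv c \<in> F"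
    "a \<in> carrier G" "b \<in> carrier G" "c \<in> carrier G" for a b c
  proof -
    have "(a \<otimes> inv b) \<otimes> (b \<otimes> inv c) = a \<otimes> inv c"
      using that(3-5) by (metis inv_closed inv_solve_left m_assoc m_closed)
    then show ?thesis using F.m_closed[OF that(1,2)] by simp
  qed
  have flip': "\<phi> (flip n x) \<otimes> inv (\<phi> x) \<notin> F" for n x
  proof (cases "x n")
    case True
    then have "\<not> flip n x n" by (simp add: flip_def)
    from flip[of "flip n x" n, OF this] show ?thesis using sw \<phi>c by fastforce
  qed (rule flip)
  define \<Theta> where "\<Theta> z = \<phi> (\<lambda>n. z (False, n)) \<otimes> inv \<phi> (\<lambda>n. z (True, n))" for z :: "bool \<times> nat \<Rightarrow> bool"
  have comp: "continuous_map cantor T (\<lambda>z. \<phi> (\<lambda>n. z (b, n)))" for b :: bool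
  proof -
    have "continuous_map cantor cantor (\<lambda>z. \<lambda>n::nat. z (b, n))"
    proof (rule continuous_map_cantor_into_cantor)
      show "\<exists>J. finite J \<and> (\<forall>x y :: bool \<times> nat \<Rightarrow> bool. (\<forall>i\<in>J. x i = y i) \<longrightarrow> x (b, j) = y (b, j))" for j :: nat
        by (rule exI[of _ "{(b, j)}"]) simp
    qed
    from continuous_map_compose[OF this \<phi>] show ?thesis by (simp add: o_def)
  qed
  have "continuous_map cantor T \<Theta>"
    unfolding \<Theta>_def by (intro continuous_map_mult continuous_map_inverse comp)
  then have "\<Theta> -` F \<in> sets (completion coin)"
    using meas unfolding coin_measurable_def by blast
  then obtain S N N' where S: "\<Theta> -` F = S \<union> N" "N \<subseteq> N'" "N' \<in> null_sets coin" "S \<in> sets coin"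
    by (rule sets_completionE)
  have "measure coin S = 0"
  proof (rule measure_zero_if_flip_disjoint[OF S(4)])
    show "infinite (range (\<lambda>n::nat. (True, n)))"
      by (rule range_inj_infinite) (simp add: inj_def)
    fix i :: "bool \<times> nat" and z assume "i \<in> range (\<lambda>n. (True, n))" and z: "z \<in> S"
    then obtain n where i: "i = (True, n)" by blast
    show "flip i z \<notin> S"
    proof
      assume "flip i z \<in> S"
      then have "\<Theta> (flip i z) \<in> F" "\<Theta> z \<in> F" using z S(1) by auto
      moreover have "(\<lambda>n. flip i z (False, n)) = (\<lambda>n. z (False, n))"
        "(\<lambda>n. flip i z (True, n)) = flip n (\<lambda>n. z (True, n))"
        by (auto simp: i flip_def)
      ultimately have "\<phi> (\<lambda>n. z (False, n)) \<otimes> inv \<phi> (flip n (\<lambda>n. z (True, n))) \<in> F"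
        "\<phi> (\<lambda>n. z (False, n)) \<otimes> inv \<phi> (\<lambda>n. z (True, n)) \<in> F"
        by (simp_all add: \<Theta>_def)
      then have "\<phi> (flip n (\<lambda>n. z (True, n))) \<otimes> inv \<phi> (\<lambda>n. z (True, n)) \<in> F"
        using sw tr \<phi>c by meson
      with flip' show False by blast
    qed
  qed
  then have null: "S \<union> N' \<in> null_sets coin"
    using S(3,4) by (intro null_sets.Un) (simp_all add: null_sets_def coin.emeasure_eq_measure)
  obtain \<Psi> :: "(nat \<Rightarrow> bool) \<Rightarrow> nat \<Rightarrow> bool" where \<Psi>: "\<And>p. \<exists>n. \<forall>x y. (\<forall>i<n. x i = y i) \<longrightarrow> \<Psi> x p = \<Psi> y p"
    "\<And>x y. x \<noteq> y \<Longrightarrow> pair_seq (\<Psi> x) (\<Psi> y) \<notin> S \<union> N'"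
    by (rule perfect_set_avoiding_null[OF null], rule that)
  show ?thesis
  proof (rule that[of "\<lambda>x. inv \<phi> (\<Psi> x)"])
    have "continuous_map cantor cantor \<Psi>"
    proof (rule continuous_map_cantor_into_cantor)
      fix j
      obtain n where "\<forall>x y. (\<forall>i<n. x i = y i) \<longrightarrow> \<Psi> x j = \<Psi> y j" using \<Psi>(1) by blast
      then show "\<exists>J. finite J \<and> (\<forall>x y. (\<forall>i\<in>J. x i = y i) \<longrightarrow> \<Psi> x j = \<Psi> y j)"
        by (intro exI[of _ "{..<n}"]) simp
    qed
    from continuous_map_compose[OF this \<phi>] show "continuous_map cantor T (\<lambda>x. inv \<phi> (\<Psi> x))"
      by (intro continuous_map_inverse) (simp add: o_def)
    fix x y :: "nat \<Rightarrow> bool" assume "x \<noteq> y"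
    then have "pair_seq (\<Psi> x) (\<Psi> y) \<notin> \<Theta> -` F" using \<Psi>(2) S(1,2) by blast
    then show "inv (inv \<phi> (\<Psi> x)) \<otimes> inv \<phi> (\<Psi> y) \<notin> F"
      using \<phi>c by (simp add: \<Theta>_def pair_seq_def)
  qed
qed

end

section \<open>Subgroups that have finite index near the identity\<close>

lemma infinite_cyl:
  assumes "finite J"
  shows "infinite (cyl J (v :: nat \<Rightarrow> bool))"
proof
  assume fin: "finite (cyl J v)"
  have "inj (\<lambda>m. flip m v)"
  proof (rule injI)
    fix m m' assume "flip m v = flip m' v"
    then have "flip m v m = flip m' v m" by simp
    then show "m = m'" by (simp add: flip_def split: if_splits)
  qed
  moreover have "flip m v \<in> cyl J v" if "m \<notin> J" for m
    unfolding cyl_def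
  proof (intro CollectI ballI)
    fix i assume "i \<in> J"
    then have "i \<noteq> m" using that by blast
    then show "flip m v i = v i" by (simp add: flip_def)
  qed
  then have "(\<lambda>m. flip m v) ` (UNIV - J) \<subseteq> cyl J v" by blast
  ultimately have "finite (UNIV - J)"
    using fin by (meson finite_imageD finite_subset inj_on_subset top_greatest)
  with assms show False by simp
qed

context polish_group
begin

lemma mult_inv_cancel:
  assumes "a \<in> carrier G" "b \<in> carrier G"
  shows "a \<otimes> (inv a \<otimes> b) = b" "inv a \<otimes> (a \<otimes> b) = b"
  using assms by (simp_all add: m_assoc[symmetric])

lemmas group_simps = m_assoc inv_mult_group mult_inv_cancel

lemma left_quotient_sym:
  assumes "subgroup K G" "inv a \<otimes> b \<in> K" "a \<in> carrier G" "b \<in> carrier G"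
  shows "inv b \<otimes> a \<in> K"
  using subgroup.m_inv_closed[OF assms(1,2)] assms(3,4) by (simp add: group_simps)

lemma left_quotient_trans:
  assumes "subgroup K G" "inv a \<otimes> b \<in> K" "inv b \<otimes> c \<in> K"
    "a \<in> carrier G" "b \<in> carrier G" "c \<in> carrier G"
  shows "inv a \<otimes> c \<in> K"
  using subgroup.m_closed[OF assms(1-3)] assms(4-6) by (simp add: group_simps)

lemma subgroup_openI:
  assumes F: "subgroup F G" and U: "openin T U" "\<one> \<in> U" "U \<subseteq> F"
  shows "openin T F"
proof (subst openin_subopen, intro ballI)
  interpret F: subgroup F G by fact
  fix x assume x: "x \<in> F"
  then have xc: "x \<in> carrier G" by simp
  let ?W = "{y \<in> carrier G. inv x \<otimes> y \<in> U}"
  have "openin T ?W"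
    using xc U(1) by (intro openin_preimage continuous_map_group_intros) auto
  moreover have "x \<in> ?W" using xc U(2) by simp
  moreover have "?W \<subseteq> F"
  proof
    fix y assume y: "y \<in> ?W"
    then have "x \<otimes> (inv x \<otimes> y) \<in> F" using x U(3) by blast
    then show "y \<in> F" using y xc by (simp add: group_simps)
  qed
  ultimately show "\<exists>W. openin T W \<and> x \<in> W \<and> W \<subseteq> F" by blast
qed

text \<open>In terms of cosets: near the identity \<open>K\<close> has only finitely many left cosets.\<close>

definition locally_finite_index :: "'a set \<Rightarrow> bool"
  where "locally_finite_index K \<longleftrightarrow> (\<exists>V S. openin T V \<and> \<one> \<in> V \<and> finite S \<and> S \<subseteq> carrier G \<and>
    (\<forall>v\<in>V. \<exists>s\<in>S. inv s \<otimes> v \<in> K))"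

lemma locally_finite_indexI:
  assumes "openin T V" "\<one> \<in> V" "finite S" "S \<subseteq> carrier G"
    and "\<And>v. v \<in> V \<Longrightarrow> \<exists>s\<in>S. inv s \<otimes> v \<in> K"
  shows "locally_finite_index K"
  unfolding locally_finite_index_def
  by (rule exI[of _ V], rule exI[of _ S], intro conjI ballI) (use assms in auto)

text \<open>A local version of B. H. Neumann's lemma on coverings by cosets. If finitely many cosets of \<open>K\<close>
  do not cover a small neighbourhood, some \<open>g\<close> in it lies outside all of those that occur.
  Translating by \<open>g\<close> shows that \<open>K\<close> itself is near the identity covered by cosets of the other
  subgroups; hence so is every coset of \<open>K\<close>, and \<open>K\<close> can be dropped from the covering.\<close>

lemma local_neumann:
  assumes "finite \<K>"
    and "\<And>K. K \<in> \<K> \<Longrightarrow> subgroup K G"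
    and "openin T W" "\<one> \<in> W"
    and "\<And>K. K \<in> \<K> \<Longrightarrow> finite (S K) \<and> S K \<subseteq> carrier G"
    and "\<And>w. w \<in> W \<Longrightarrow> \<exists>K\<in>\<K>. \<exists>s\<in>S K. inv s \<otimes> w \<in> K"
  shows "\<exists>K\<in>\<K>. locally_finite_index K"
  using assms
proof (induction \<K> arbitrary: W S rule: finite_induct)
  case (insert K \<K>)
  note W = insert.prems(2,3) and cover = insert.prems(5)
  have K: "subgroup K G" and finS: "finite (S K)" and SK: "S K \<subseteq> carrier G"
    using insert.prems(1,4) by auto
  interpret K: subgroup K G by fact
  show ?case
  proof (cases "locally_finite_index K")
    case False
    obtain W1 where W1: "openin T W1" "\<one> \<in> W1" "\<And>x y. x \<in> W1 \<Longrightarrow> y \<in> W1 \<Longrightarrow> x \<otimes> y \<in> W"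
      using nbhd_mult[OF W] by metis
    have W1c: "W1 \<subseteq> carrier G" using W1(1) by (rule openin_subset_carrier)
    have "\<not> (\<forall>g\<in>W1. \<exists>s\<in>S K. inv s \<otimes> g \<in> K)"
      using False locally_finite_indexI[OF W1(1,2) finS SK] by blast
    then obtain g where g: "g \<in> W1" "\<And>s. s \<in> S K \<Longrightarrow> inv s \<otimes> g \<notin> K"
      by blast
    have gc: "g \<in> carrier G" using g W1c by blast
    have trace: "\<exists>L\<in>\<K>. \<exists>t\<in>S L. inv (inv g \<otimes> t) \<otimes> k \<in> L" if k: "k \<in> K" "k \<in> W1" for k
    proof -
      have kc: "k \<in> carrier G" using k by simp
      obtain L t where L: "L \<in> insert K \<K>" "t \<in> S L" "inv t \<otimes> (g \<otimes> k) \<in> L"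
        using cover[OF W1(3)[OF g(1) k(2)]] by blast
      have tc: "t \<in> carrier G" using insert.prems(4)[OF L(1)] L(2) by blast
      have "L \<noteq> K"
      proof
        assume "L = K"
        then have "(inv t \<otimes> (g \<otimes> k)) \<otimes> inv k \<in> K" using L(3) k(1) by blast
        then have "inv t \<otimes> g \<in> K" using tc gc kc by (simp add: group_simps)
        then show False using g(2) L(2) \<open>L = K\<close> by blast
      qed
      then show ?thesis using L tc gc kc by (auto simp: group_simps intro!: bexI[of _ L] bexI[of _ t])
    qed
    obtain V where V: "openin T V" "\<one> \<in> V" "\<And>x y. x \<in> V \<Longrightarrow> y \<in> V \<Longrightarrow> inv x \<otimes> y \<in> W1"
      using nbhd_div[OF W1(1,2)] by metis
    have VW: "openin T (V \<inter> W)" "\<one> \<in> V \<inter> W" using V W by auto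
    have VWc: "V \<inter> W \<subseteq> carrier G" using VW(1) by (rule openin_subset_carrier)
    \<comment> \<open>inside a coset of \<open>K\<close> that meets the neighbourhood, \<open>h s\<close> is a new representative lying in it\<close>
    have "\<exists>h. h \<in> carrier G \<and> (\<forall>w\<in>V \<inter> W. inv s \<otimes> w \<in> K \<longrightarrow> h \<in> V \<and> inv s \<otimes> h \<in> K)" for s
      using VWc by (cases "\<exists>w\<in>V \<inter> W. inv s \<otimes> w \<in> K") auto
    then obtain h where h: "\<And>s. h s \<in> carrier G"
      "\<And>s w. w \<in> V \<inter> W \<Longrightarrow> inv s \<otimes> w \<in> K \<Longrightarrow> h s \<in> V \<and> inv s \<otimes> h s \<in> K" by metis
    define S' where "S' L = S L \<union> (\<lambda>(s, t). h s \<otimes> (inv g \<otimes> t)) ` (S K \<times> S L)" for L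
    have "\<exists>L\<in>\<K>. locally_finite_index L"
    proof (rule insert.IH[OF _ VW, of S'])
      show "subgroup L G" if "L \<in> \<K>" for L using that insert.prems(1) by blast
      show "finite (S' L) \<and> S' L \<subseteq> carrier G" if L: "L \<in> \<K>" for L
      proof -
        have "finite (S L)" "S L \<subseteq> carrier G" using insert.prems(4) L by auto
        then show ?thesis using finS h(1) gc by (auto simp: S'_def subset_iff)
      qed
      fix w assume w: "w \<in> V \<inter> W"
      then have wc: "w \<in> carrier G" using VWc by blast
      obtain L s where L: "L \<in> insert K \<K>" "s \<in> S L" "inv s \<otimes> w \<in> L"
        using cover w by blast
      show "\<exists>L\<in>\<K>. \<exists>s\<in>S' L. inv s \<otimes> w \<in> L"
      proof (cases "L \<in> \<K>")
        case True
        then show ?thesis using L unfolding S'_def by blast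
      next
        case False
        then have s: "s \<in> S K" "inv s \<otimes> w \<in> K" using L by auto
        then have sc: "s \<in> carrier G" using SK by blast
        have hs: "h s \<in> V" "inv s \<otimes> h s \<in> K" using h(2)[OF w s(2)] by auto
        have "inv (h s) \<otimes> w \<in> K"
          using left_quotient_trans[OF K left_quotient_sym[OF K hs(2)] s(2)] sc wc h(1) by simp
        moreover have "inv (h s) \<otimes> w \<in> W1" using V(3) hs(1) w by blast
        ultimately obtain L' t where L': "L' \<in> \<K>" "t \<in> S L'" "inv (inv g \<otimes> t) \<otimes> (inv (h s) \<otimes> w) \<in> L'"
          using trace by blast
        have tc: "t \<in> carrier G" using insert.prems(4) L'(1,2) by blast
        have "inv (inv g \<otimes> t) \<otimes> (inv (h s) \<otimes> w) = inv (h s \<otimes> (inv g \<otimes> t)) \<otimes> w"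
          using tc gc wc h(1)[of s] by (simp add: group_simps)
        moreover have "h s \<otimes> (inv g \<otimes> t) \<in> S' L'"
          unfolding S'_def by (rule UnI2, rule image_eqI[of _ _ "(s, t)"]) (use s(1) L'(2) in simp_all)
        ultimately show ?thesis using L'(1,3) by metis
      qed
    qed
    then show ?thesis by blast
  qed simp
qed auto

lemma subgroup_conjugate:
  assumes F: "subgroup F G" and a: "a \<in> carrier G"
  shows "subgroup {g \<in> carrier G. a \<otimes> g \<otimes> inv a \<in> F} G"
proof -
  interpret F: subgroup F G by fact
  show ?thesis
  proof (rule subgroupI)
    show "{g \<in> carrier G. a \<otimes> g \<otimes> inv a \<in> F} \<noteq> {}"
      using a by (auto intro!: exI[of _ \<one>])
    show "inv g \<in> {g \<in> carrier G. a \<otimes> g \<otimes> inv a \<in> F}" if "g \<in> {g \<in> carrier G. a \<otimes> g \<otimes> inv a \<in> F}" for g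
      using that a F.m_inv_closed[of "a \<otimes> g \<otimes> inv a"] by (auto simp: group_simps)
    show "g \<otimes> h \<in> {g \<in> carrier G. a \<otimes> g \<otimes> inv a \<in> F}"
      if "g \<in> {g \<in> carrier G. a \<otimes> g \<otimes> inv a \<in> F}" "h \<in> {g \<in> carrier G. a \<otimes> g \<otimes> inv a \<in> F}" for g h
      using that a F.m_closed[of "a \<otimes> g \<otimes> inv a" "a \<otimes> h \<otimes> inv a"] by (auto simp: group_simps)
  qed auto
qed

lemma locally_finite_index_conjugate:
  assumes a: "a \<in> carrier G"
    and "locally_finite_index {g \<in> carrier G. a \<otimes> g \<otimes> inv a \<in> F}"
  shows "locally_finite_index F"
proof -
  obtain V S where V: "openin T V" "\<one> \<in> V" and S: "finite S" "S \<subseteq> carrier G"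
    and cov: "\<And>v. v \<in> V \<Longrightarrow> \<exists>s\<in>S. inv s \<otimes> v \<in> {g \<in> carrier G. a \<otimes> g \<otimes> inv a \<in> F}"
    using assms(2) unfolding locally_finite_index_def by blast
  let ?V = "{x \<in> carrier G. inv a \<otimes> x \<otimes> a \<in> V}" and ?S = "(\<lambda>s. a \<otimes> s \<otimes> inv a) ` S"
  have "openin T ?V"
    using a V(1) by (intro openin_preimage continuous_map_group_intros) auto
  moreover have "\<one> \<in> ?V" using a V(2) by simp
  moreover have "finite ?S" "?S \<subseteq> carrier G" using S a by auto
  moreover have "\<exists>s\<in>?S. inv s \<otimes> x \<in> F" if x: "x \<in> ?V" for x
  proof -
    obtain s where s: "s \<in> S" "a \<otimes> (inv s \<otimes> (inv a \<otimes> x \<otimes> a)) \<otimes> inv a \<in> F"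
      using cov x by blast
    then have "inv (a \<otimes> s \<otimes> inv a) \<otimes> x \<in> F"
      using x a S(2) by (simp add: group_simps subset_iff)
    then show ?thesis using s(1) by blast
  qed
  ultimately show ?thesis by (rule locally_finite_indexI)
qed

text \<open>Let \<open>H\<close> be the closure of \<open>F\<close>. It is an open subgroup in which \<open>F\<close> has finite index, so the
  intersection \<open>N\<close> of the conjugates of \<open>F\<close> by elements of \<open>H\<close> is a finite intersection and
  inherits measurability. If \<open>F\<close> is not open, no neighbourhood of the identity in \<open>H\<close> lies in \<open>N\<close>;
  since \<open>N\<close> is normal in \<open>H\<close>, avoiding \<open>N\<close> is the same as avoiding all conjugates of \<open>N\<close>, and the
  product construction yields infinitely many elements close to each other that are inequivalent
  modulo \<open>N\<close>. This contradicts the finiteness of the permutation action of \<open>H\<close> on \<open>H\<close> modulo \<open>F\<close>,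
  whose kernel is \<open>N\<close>.\<close>

lemma open_if_locally_finite_index:
  assumes F: "subgroup F G" and meas: "coin_measurable F" and lfi: "locally_finite_index F"
  shows "openin T F"
proof (rule ccontr)
  assume not_open: "\<not> openin T F"
  interpret F: subgroup F G by fact
  obtain V S where V: "openin T V" "\<one> \<in> V" and S: "finite S" "S \<subseteq> carrier G"
    and cov: "\<And>v. v \<in> V \<Longrightarrow> \<exists>s\<in>S. inv s \<otimes> v \<in> F"
    using lfi unfolding locally_finite_index_def by blast
  have Vc: "V \<subseteq> carrier G" using V(1) by (rule openin_subset_carrier)
  \<comment> \<open>the closure of \<open>F\<close>, written as the intersection of all \<open>W F\<close>\<close>
  define H where "H = {x \<in> carrier G. \<forall>W. openin T W \<longrightarrow> \<one> \<in> W \<longrightarrow> (\<exists>w\<in>W. inv w \<otimes> x \<in> F)}"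
  have Hc: "H \<subseteq> carrier G" by (auto simp: H_def)
  have HD: "\<exists>w\<in>W. w \<in> carrier G \<and> inv w \<otimes> x \<in> F" if "x \<in> H" "openin T W" "\<one> \<in> W" for x W
    using that openin_subset_carrier[OF that(2)] unfolding H_def by blast
  have FH: "F \<subseteq> H"
  proof
    fix x assume "x \<in> F"
    then have "x \<in> carrier G" "inv \<one> \<otimes> x \<in> F" by simp_all
    then show "x \<in> H" unfolding H_def by blast
  qed
  have H_mult: "x \<otimes> y \<in> H" if x: "x \<in> H" and y: "y \<in> H" for x y
    unfolding H_def
  proof (intro CollectI conjI allI impI)
    have c: "x \<in> carrier G" "y \<in> carrier G" using x y Hc by auto
    then show "x \<otimes> y \<in> carrier G" by simp
    fix W assume W: "openin T W" "\<one> \<in> W"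
    obtain W1 where W1: "openin T W1" "\<one> \<in> W1" "\<And>x y. x \<in> W1 \<Longrightarrow> y \<in> W1 \<Longrightarrow> x \<otimes> y \<in> W"
      using nbhd_mult[OF W] by metis
    obtain w1 where w1: "w1 \<in> W1" "w1 \<in> carrier G" "inv w1 \<otimes> x \<in> F"
      using HD[OF x W1(1,2)] by blast
    define f where "f = inv w1 \<otimes> x"
    have fc: "f \<in> carrier G" and f: "f \<in> F" using w1 c by (auto simp: f_def)
    have xf: "x = w1 \<otimes> f" using c w1 by (simp add: f_def group_simps)
    have "openin T {z \<in> carrier G. f \<otimes> z \<otimes> inv f \<in> W1}"
      using fc W1(1) by (intro openin_preimage continuous_map_group_intros) auto
    moreover have "\<one> \<in> {z \<in> carrier G. f \<otimes> z \<otimes> inv f \<in> W1}" using fc W1(2) by simp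
    ultimately obtain w2 where w2: "f \<otimes> w2 \<otimes> inv f \<in> W1" "w2 \<in> carrier G" "inv w2 \<otimes> y \<in> F"
      using HD[OF y] by blast
    have "inv (w1 \<otimes> (f \<otimes> w2 \<otimes> inv f)) \<otimes> (x \<otimes> y) = f \<otimes> (inv w2 \<otimes> y)"
      using w1(2) w2(2) fc c unfolding xf by (simp add: group_simps)
    also have "\<dots> \<in> F" using f w2(3) by (rule F.m_closed)
    finally show "\<exists>w\<in>W. inv w \<otimes> (x \<otimes> y) \<in> F" using W1(3)[OF w1(1) w2(1)] by blast
  qed
  have H_inv: "inv x \<in> H" if x: "x \<in> H" for x
    unfolding H_def
  proof (intro CollectI conjI allI impI)
    have xc: "x \<in> carrier G" using x Hc by auto
    then show "inv x \<in> carrier G" by simp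
    fix W assume W: "openin T W" "\<one> \<in> W"
    have "openin T {z \<in> carrier G. inv x \<otimes> inv z \<otimes> x \<in> W}"
      using xc W(1) by (intro openin_preimage continuous_map_group_intros) auto
    moreover have "\<one> \<in> {z \<in> carrier G. inv x \<otimes> inv z \<otimes> x \<in> W}" using xc W(2) by simp
    ultimately obtain w where w: "inv x \<otimes> inv w \<otimes> x \<in> W" "w \<in> carrier G" "inv w \<otimes> x \<in> F"
      using HD[OF x] by blast
    have "inv (inv x \<otimes> inv w \<otimes> x) \<otimes> inv x = inv (inv w \<otimes> x)"
      using w(2) xc by (simp add: group_simps)
    also have "\<dots> \<in> F" using w(3) by (rule F.m_inv_closed)
    finally show "\<exists>w\<in>W. inv w \<otimes> inv x \<in> F" using w(1) by blast
  qed
  \<comment> \<open>a coset not contained in \<open>H\<close> stays away from the identity, and the remaining ones lie in \<open>H\<close>\<close>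
  obtain U where U: "openin T U" "\<one> \<in> U" "U \<subseteq> H"
  proof -
    have "\<exists>W. openin T W \<and> \<one> \<in> W \<and> (\<forall>w\<in>W. inv w \<otimes> s \<notin> F)" if "s \<in> S - H" for s
      using that S(2) unfolding H_def by blast
    then obtain W where W: "\<And>s. s \<in> S - H \<Longrightarrow> openin T (W s)" "\<And>s. s \<in> S - H \<Longrightarrow> \<one> \<in> W s"
      "\<And>s w. s \<in> S - H \<Longrightarrow> w \<in> W s \<Longrightarrow> inv w \<otimes> s \<notin> F" by metis
    show ?thesis
    proof (rule that)
      show "openin T (V \<inter> ((\<Inter>s\<in>S - H. W s) \<inter> topspace T))"
        using S(1) W(1) V(1) by (intro openin_Int openin_INT) auto
      show "\<one> \<in> V \<inter> ((\<Inter>s\<in>S - H. W s) \<inter> topspace T)"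
        using W(2) V(2) topspace_eq_carrier by simp
      show "V \<inter> ((\<Inter>s\<in>S - H. W s) \<inter> topspace T) \<subseteq> H"
      proof
        fix v assume v: "v \<in> V \<inter> ((\<Inter>s\<in>S - H. W s) \<inter> topspace T)"
        then have vc: "v \<in> carrier G" using Vc by blast
        obtain s where s: "s \<in> S" "inv s \<otimes> v \<in> F" using cov v by blast
        then have sc: "s \<in> carrier G" using S by blast
        have "s \<in> H"
          using W(3)[of s v] v s left_quotient_sym[OF F s(2) sc vc] by blast
        then have "s \<otimes> (inv s \<otimes> v) \<in> H" using s(2) FH H_mult by blast
        then show "v \<in> H" using sc vc by (simp add: group_simps)
      qed
    qed
  qed
  \<comment> \<open>representatives of the finitely many cosets of \<open>F\<close> in \<open>H\<close>\<close>
  define R where "R = S \<inter> H"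
  have R: "finite R" "R \<subseteq> H" "R \<subseteq> carrier G" using S Hc by (auto simp: R_def)
  have rep: "\<exists>s\<in>R. inv s \<otimes> x \<in> F" if x: "x \<in> H" for x
  proof -
    have xc: "x \<in> carrier G" using x Hc by blast
    obtain w where w: "w \<in> V" "w \<in> carrier G" "inv w \<otimes> x \<in> F" using HD[OF x V] by blast
    obtain s where s: "s \<in> S" "inv s \<otimes> w \<in> F" using cov[OF w(1)] by blast
    have sc: "s \<in> carrier G" using s S by blast
    have sx: "inv s \<otimes> x \<in> F" by (rule left_quotient_trans[OF F s(2) w(3) sc w(2) xc])
    have "x \<otimes> inv (inv s \<otimes> x) \<in> H" using sx FH x H_mult H_inv by blast
    then have "s \<in> H" using sc xc by (simp add: group_simps)
    then show ?thesis using s sx by (auto simp: R_def)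
  qed
  define N where "N = {x \<in> carrier G. \<forall>s\<in>R. inv s \<otimes> x \<otimes> s \<in> F}"
  have N_iff: "x \<in> N \<longleftrightarrow> (\<forall>h\<in>H. inv h \<otimes> x \<otimes> h \<in> F)" if xc: "x \<in> carrier G" for x
  proof
    assume x: "x \<in> N"
    show "\<forall>h\<in>H. inv h \<otimes> x \<otimes> h \<in> F"
    proof
      fix h assume h: "h \<in> H"
      then obtain s where s: "s \<in> R" "inv s \<otimes> h \<in> F" using rep by blast
      have c: "h \<in> carrier G" "s \<in> carrier G" using h s Hc R by auto
      have "inv s \<otimes> x \<otimes> s \<in> F" using x s(1) by (simp add: N_def)
      from F.m_closed[OF F.m_closed[OF F.m_inv_closed[OF s(2)] this] s(2)]
      have "inv (inv s \<otimes> h) \<otimes> (inv s \<otimes> x \<otimes> s) \<otimes> (inv s \<otimes> h) \<in> F" .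
      moreover have "inv (inv s \<otimes> h) \<otimes> (inv s \<otimes> x \<otimes> s) \<otimes> (inv s \<otimes> h) = inv h \<otimes> x \<otimes> h"
        using c xc by (simp add: group_simps)
      ultimately show "inv h \<otimes> x \<otimes> h \<in> F" by simp
    qed
  next
    assume "\<forall>h\<in>H. inv h \<otimes> x \<otimes> h \<in> F"
    then show "x \<in> N" using R(2) xc unfolding N_def by blast
  qed
  have oneH: "\<one> \<in> H" using FH F.one_closed by (rule subsetD)
  have NF: "N \<subseteq> F"
  proof
    fix x assume x: "x \<in> N"
    then have xc: "x \<in> carrier G" by (simp add: N_def)
    then have "inv \<one> \<otimes> x \<otimes> \<one> \<in> F" using x N_iff oneH by blast
    then show "x \<in> F" using xc by simp
  qed
  have N: "subgroup N G"
  proof (rule subgroupI)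
    show "N \<noteq> {}" using R by (auto simp: N_def subset_iff intro!: exI[of _ \<one>])
    show "inv x \<in> N" if x: "x \<in> N" for x
    proof -
      have xc: "x \<in> carrier G" using x by (simp add: N_def)
      have "inv s \<otimes> inv x \<otimes> s \<in> F" if s: "s \<in> R" for s
      proof -
        have "inv (inv s \<otimes> x \<otimes> s) \<in> F" using x s by (auto simp: N_def)
        then show ?thesis using xc s R by (simp add: group_simps subset_iff)
      qed
      then show ?thesis using xc by (simp add: N_def)
    qed
    show "x \<otimes> y \<in> N" if x: "x \<in> N" and y: "y \<in> N" for x y
    proof -
      have c: "x \<in> carrier G" "y \<in> carrier G" using x y by (simp_all add: N_def)
      have "inv s \<otimes> (x \<otimes> y) \<otimes> s \<in> F" if s: "s \<in> R" for s
      proof -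
        have "(inv s \<otimes> x \<otimes> s) \<otimes> (inv s \<otimes> y \<otimes> s) \<in> F" using x y s by (auto simp: N_def)
        then show ?thesis using c s R by (simp add: group_simps subset_iff)
      qed
      then show ?thesis using c by (simp add: N_def)
    qed
  qed (auto simp: N_def)
  have N_normal: "x \<in> N" if "a \<in> H" "x \<in> carrier G" "a \<otimes> x \<otimes> inv a \<in> N" for a x
  proof -
    have ac: "a \<in> carrier G" using that Hc by blast
    have "inv h \<otimes> x \<otimes> h \<in> F" if h: "h \<in> H" for h
    proof -
      have hc: "h \<in> carrier G" using h Hc by blast
      have "inv (a \<otimes> h) \<otimes> (a \<otimes> x \<otimes> inv a) \<otimes> (a \<otimes> h) \<in> F"
        using N_iff[of "a \<otimes> x \<otimes> inv a"] \<open>a \<otimes> x \<otimes> inv a \<in> N\<close> H_mult[OF \<open>a \<in> H\<close> h] ac \<open>x \<in> carrier G\<close> by simp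
      then show ?thesis using ac hc \<open>x \<in> carrier G\<close> by (simp add: group_simps)
    qed
    then show ?thesis using N_iff \<open>x \<in> carrier G\<close> by blast
  qed
  have N_meas: "coin_measurable N"
    unfolding coin_measurable_def
  proof (intro allI impI)
    fix \<Theta> :: "(bool \<times> nat \<Rightarrow> bool) \<Rightarrow> 'a" assume \<Theta>: "continuous_map cantor T \<Theta>"
    have \<Theta>c: "\<Theta> z \<in> carrier G" for z
      using continuous_map_image_subset_topspace[OF \<Theta>] topspace_eq_carrier by auto
    have "\<Theta> -` N = (\<Inter>s\<in>R. (\<lambda>z. inv s \<otimes> \<Theta> z \<otimes> s) -` F)"
      using \<Theta>c by (auto simp: N_def)
    also have "\<dots> \<in> sets (completion coin)"
    proof (rule sets.finite_INT)
      show "R \<noteq> {}" using rep[OF oneH] by blast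
      show "(\<lambda>z. inv s \<otimes> \<Theta> z \<otimes> s) -` F \<in> sets (completion coin)" if s: "s \<in> R" for s
      proof -
        have "continuous_map cantor T (\<lambda>z. inv s \<otimes> \<Theta> z \<otimes> s)"
          using s R by (intro continuous_map_mult continuous_map_const_carrier \<Theta>) auto
        then show ?thesis using meas unfolding coin_measurable_def by blast
      qed
    qed (rule R)
    finally show "\<Theta> -` N \<in> sets (completion coin)" .
  qed
  have avoid: "\<exists>g\<in>W \<inter> H. \<forall>a\<in>A. a \<otimes> g \<otimes> inv a \<notin> N"
    if A: "A \<subseteq> H" and W: "openin T W" "\<one> \<in> W" for A W
  proof (rule ccontr)
    assume neg: "\<not> ?thesis"
    have "W \<inter> U \<subseteq> F"
    proof
      fix g assume g: "g \<in> W \<inter> U"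
      then obtain a where "a \<in> A" "a \<otimes> g \<otimes> inv a \<in> N" using neg U(3) by blast
      then have "g \<in> N" using N_normal[of a g] A g U(3) Hc by blast
      then show "g \<in> F" using NF by blast
    qed
    then have "openin T F"
      using subgroup_openI[OF F, of "W \<inter> U"] W U by auto
    with not_open show False ..
  qed
  obtain \<phi> :: "(nat \<Rightarrow> bool) \<Rightarrow> 'a" where "continuous_map cantor T \<phi>"
    "\<And>n x. \<not> x n \<Longrightarrow> \<phi> (flip n x) \<otimes> inv (\<phi> x) \<notin> N"
    using convergent_products[of H N] oneH Hc H_mult avoid by metis
  then obtain f :: "(nat \<Rightarrow> bool) \<Rightarrow> 'a"
    where f: "continuous_map cantor T f" "\<And>x y. x \<noteq> y \<Longrightarrow> inv (f x) \<otimes> f y \<notin> N"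
    using cantor_transversal_if_flips_leave[OF N N_meas] by metis
  have fc: "f x \<in> carrier G" for x
    using continuous_map_image_subset_topspace[OF f(1)] topspace_eq_carrier by auto
  define x\<^sub>0 where "x\<^sub>0 = (\<lambda>_::nat. False)"
  have "openin T {y \<in> carrier G. inv (f x\<^sub>0) \<otimes> y \<in> U}"
    using fc U(1) by (intro openin_preimage continuous_map_group_intros) auto
  from openin_continuous_map_preimage[OF f(1) this]
  have "openin cantor {x. f x \<in> carrier G \<and> inv (f x\<^sub>0) \<otimes> f x \<in> U}" by simp
  moreover have "x\<^sub>0 \<in> {x. f x \<in> carrier G \<and> inv (f x\<^sub>0) \<otimes> f x \<in> U}" using fc U(2) by simp
  ultimately obtain J where J: "finite J" "cyl J x\<^sub>0 \<subseteq> {x. f x \<in> carrier G \<and> inv (f x\<^sub>0) \<otimes> f x \<in> U}"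
    unfolding openin_cantor_iff by blast
  define h where "h x = inv (f x\<^sub>0) \<otimes> f x" for x
  have hH: "h x \<in> H" if "x \<in> cyl J x\<^sub>0" for x
    using J(2) that U(3) by (auto simp: h_def)
  have hc: "h x \<in> carrier G" for x using fc by (simp add: h_def)
  have "\<exists>t. t \<in> R \<and> inv t \<otimes> (h x \<otimes> s) \<in> F" if "x \<in> cyl J x\<^sub>0" "s \<in> R" for x s
    using rep[OF H_mult[OF hH[OF that(1)]]] that(2) R(2) by blast
  \<comment> \<open>\<open>c x\<close> is the permutation of the cosets of \<open>F\<close> in \<open>H\<close> induced by \<open>h x\<close>\<close>
  then obtain c where c: "\<And>x s. x \<in> cyl J x\<^sub>0 \<Longrightarrow> s \<in> R \<Longrightarrow> c x s \<in> R \<and> inv (c x s) \<otimes> (h x \<otimes> s) \<in> F"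
    by metis
  have "inj_on (\<lambda>x. restrict (c x) R) (cyl J x\<^sub>0)"
  proof (rule inj_onI, rule ccontr)
    fix x y assume xy: "x \<in> cyl J x\<^sub>0" "y \<in> cyl J x\<^sub>0" "restrict (c x) R = restrict (c y) R" "x \<noteq> y"
    have "inv s \<otimes> (inv (f x) \<otimes> f y) \<otimes> s \<in> F" if s: "s \<in> R" for s
    proof -
      have eq: "c x s = c y s" using xy(3) s by (metis restrict_apply')
      have sc: "s \<in> carrier G" "c x s \<in> carrier G" using s c[OF xy(1) s] R by auto
      have "inv (h x \<otimes> s) \<otimes> (h y \<otimes> s) \<in> F"
      proof (rule left_quotient_trans[OF F left_quotient_sym[OF F]])
        show "inv (c x s) \<otimes> (h x \<otimes> s) \<in> F" "inv (c x s) \<otimes> (h y \<otimes> s) \<in> F"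
          using c[OF xy(1) s] c[OF xy(2) s] eq by auto
      qed (use sc hc in auto)
      then show ?thesis using sc fc by (simp add: h_def group_simps)
    qed
    then have "inv (f x) \<otimes> f y \<in> N" using fc by (simp add: N_def)
    with f(2)[OF xy(4)] show False ..
  qed
  moreover have "(\<lambda>x. restrict (c x) R) ` cyl J x\<^sub>0 \<subseteq> PiE R (\<lambda>_. R)"
    using c by auto
  moreover have "finite (PiE R (\<lambda>_. R))" using R(1) by (intro finite_PiE) auto
  ultimately have "finite (cyl J x\<^sub>0)" by (meson finite_imageD finite_subset)
  with infinite_cyl[OF J(1)] show False by blast
qed

section \<open>The dichotomy and its consequence\<close>

text \<open>The product construction can fail only if finitely many conjugates of \<open>F\<close> cover a
  neighbourhood of the identity. By the local version of Neumann's lemma one of the conjugates,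
  and hence \<open>F\<close>, then has finite index near the identity, so that \<open>F\<close> is open.\<close>

lemma cantor_transversal_if_not_open:
  assumes F: "subgroup F G" and meas: "coin_measurable F" and not_open: "\<not> openin T F"
  obtains f :: "(nat \<Rightarrow> bool) \<Rightarrow> 'a"
  where "continuous_map cantor T f" "\<And>x y. x \<noteq> y \<Longrightarrow> inv (f x) \<otimes> f y \<notin> F"
proof -
  have avoid: "\<exists>g\<in>W \<inter> carrier G. \<forall>a\<in>A. a \<otimes> g \<otimes> inv a \<notin> F"
    if A: "finite A" "A \<subseteq> carrier G" and W: "openin T W" "\<one> \<in> W" for A W
  proof (rule ccontr)
    assume "\<not> ?thesis"
    then have neg: "\<And>g. g \<in> W \<Longrightarrow> \<exists>a\<in>A. a \<otimes> g \<otimes> inv a \<in> F"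
      using openin_subset_carrier[OF W(1)] by blast
    define C where "C a = {g \<in> carrier G. a \<otimes> g \<otimes> inv a \<in> F}" for a
    have "\<exists>K\<in>C ` A. locally_finite_index K"
    proof (rule local_neumann[OF _ _ W, of _ "\<lambda>_. {\<one>}"])
      show "subgroup K G" if "K \<in> C ` A" for K
        using that A(2) subgroup_conjugate[OF F] by (auto simp: C_def)
      show "\<exists>K\<in>C ` A. \<exists>s\<in>{\<one>}. inv s \<otimes> w \<in> K" if "w \<in> W" for w
      proof -
        have "w \<in> carrier G" using openin_subset_carrier[OF W(1)] that by blast
        then show ?thesis using neg[OF that] by (simp add: C_def)
      qed
    qed (use A in auto)
    then obtain a where "a \<in> A" "locally_finite_index (C a)" by blast
    then have "locally_finite_index F"
      using locally_finite_index_conjugate[of a F] A(2) by (auto simp: C_def)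
    with open_if_locally_finite_index[OF F meas] not_open show False by blast
  qed
  obtain \<phi> :: "(nat \<Rightarrow> bool) \<Rightarrow> 'a" where "continuous_map cantor T \<phi>"
    "\<And>n x. \<not> x n \<Longrightarrow> \<phi> (flip n x) \<otimes> inv (\<phi> x) \<notin> F"
    by (rule convergent_products[of "carrier G" F]) (use avoid in auto)
  then show ?thesis
    using cantor_transversal_if_flips_leave[OF F meas] that by metis
qed

lemma perfect_index_if_cantor_transversal:
  assumes F: "subgroup F G" and f: "continuous_map cantor T f"
    and ineq: "\<And>x y :: nat \<Rightarrow> bool. x \<noteq> y \<Longrightarrow> inv (f x) \<otimes> f y \<notin> F"
  shows "has_perfect_index G T F"
proof -
  interpret F: subgroup F G by fact
  have fc: "f x \<in> carrier G" for x
    using continuous_map_image_subset_topspace[OF f] topspace_eq_carrier by auto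
  have neq: "f x \<noteq> f y" if "x \<noteq> y" for x y
    using ineq[OF that] fc[of x] by (metis F.one_closed l_inv)
  have "compactin T (range f)"
    using image_compactin[OF _ f, of UNIV] compact_space_cantor by (simp add: compact_space_def)
  moreover have "Hausdorff_space T"
    using polish unfolding polish_topology_def
    by (simp add: completely_metrizable_imp_metrizable_space metrizable_imp_Hausdorff_space)
  ultimately have closed: "closedin T (range f)"
    by (rule compactin_imp_closedin[rotated])
  have "f x \<in> T derived_set_of range f" for x
    unfolding in_derived_set_of
  proof (intro conjI allI impI)
    show "f x \<in> topspace T" using fc topspace_eq_carrier by simp
    fix U assume U: "f x \<in> U \<and> openin T U"
    then have "openin cantor {y \<in> topspace cantor. f y \<in> U}"
      using openin_continuous_map_preimage[OF f] by blast
    then obtain J where J: "finite J" "cyl J x \<subseteq> {y. f y \<in> U}"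
      using U unfolding openin_cantor_iff by auto
    obtain y where "y \<in> cyl J x" "y \<noteq> x"
      using infinite_cyl[OF J(1), of x] by (metis finite.simps finite_subset insertCI subsetI)
    then show "\<exists>y\<noteq>f x. y \<in> range f \<and> y \<in> U" using J(2) neq by blast
  qed
  then have "perfect_set T (range f)"
    unfolding perfect_set_def using closed by blast
  moreover have "(f x <# F) \<inter> (f y <# F) = {}" if xy: "f x \<noteq> f y" for x y
  proof (rule ccontr)
    assume "\<not> ?thesis"
    then obtain a b where ab: "a \<in> F" "b \<in> F" "f x \<otimes> a = f y \<otimes> b"
      unfolding l_coset_def by blast
    have "inv (f x) \<otimes> f y = inv (f x) \<otimes> (f y \<otimes> b) \<otimes> inv b"
      using ab(2) fc by (simp add: group_simps)
    also have "\<dots> = a \<otimes> inv b"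
      using ab fc by (simp add: ab(3)[symmetric] group_simps)
    also have "\<dots> \<in> F" using ab by blast
    finally have "inv (f x) \<otimes> f y \<in> F" .
    moreover have "x \<noteq> y" using xy by blast
    ultimately show False using ineq by blast
  qed
  ultimately show ?thesis
    unfolding has_perfect_index_def perfect_set_of_disjoint_left_translates_def
    using F by (intro conjI exI[of _ "range f"]) auto
qed

end

lemma no_injection_cantor_nat: "\<not> inj (k :: (nat \<Rightarrow> bool) \<Rightarrow> nat)"
proof
  assume k: "inj k"
  define d where "d n = (\<not> inv_into UNIV k n n)" for n
  have "inv_into UNIV k (k d) = d" using k by simp
  then show False using d_def[of "k d"] by simp
qed

text \<open>The cosets of the stabiliser of \<open>n\<close> correspond to values \<open>\<pi> x n\<close>, so there are only countably
  many of them. A Cantor set of inequivalent points would be uncountable; hence every stabiliser is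
  open, and so are its cosets, of which the preimages of basic open sets are finite intersections.\<close>

lemma (in polish_group) universally_measurable_hom_continuous:
  assumes hom: "\<pi> \<in> hom G S_inf" and um: "universally_measurable_map T S_inf_topology \<pi>"
  shows "continuous_map T S_inf_topology \<pi>"
proof -
  have bij: "bij (\<pi> x)" if "x \<in> carrier G" for x
    using hom that carrier_S_inf by (auto simp: hom_def)
  have mult: "\<pi> (x \<otimes> y) n = \<pi> x (\<pi> y n)" if "x \<in> carrier G" "y \<in> carrier G" for x y n
    using hom_mult[OF hom that] mult_S_inf bij that by simp
  have one: "\<pi> \<one> n = n" for n
    using mult[of \<one> \<one> n] bij[of \<one>] by (simp add: bij_def inj_eq)
  have quot: "\<pi> (inv x \<otimes> y) n = n \<longleftrightarrow> \<pi> x n = \<pi> y n" if "x \<in> carrier G" "y \<in> carrier G" for x y n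
  proof -
    have "\<pi> x (\<pi> (inv x \<otimes> y) n) = \<pi> y n"
      using mult[of x "inv x \<otimes> y" n] that by (simp add: group_simps)
    then show ?thesis using bij[OF that(1)] by (metis bij_def inj_eq)
  qed
  have stab_open: "openin T {x \<in> carrier G. \<pi> x n = n}" (is "openin T ?F") for n
  proof (rule ccontr)
    assume not_open: "\<not> openin T ?F"
    have F: "subgroup ?F G"
    proof (rule subgroupI)
      show "?F \<noteq> {}" using one by (auto intro!: exI[of _ \<one>])
      show "inv x \<in> ?F" if "x \<in> ?F" for x
        using that quot[of x \<one> n] one by auto
      show "x \<otimes> y \<in> ?F" if "x \<in> ?F" "y \<in> ?F" for x y
        using that mult by auto
    qed auto
    have "openin S_inf_topology (S_inf_basic_open {(n, n)})"
      unfolding S_inf_topology_def by (rule topology_generated_by_Basis) blast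
    then have "universally_measurable T {x \<in> topspace T. \<pi> x \<in> S_inf_basic_open {(n, n)}}"
      using um unfolding universally_measurable_map_def by blast
    moreover have "{x \<in> topspace T. \<pi> x \<in> S_inf_basic_open {(n, n)}} = ?F"
      using bij topspace_eq_carrier by (auto simp: S_inf_basic_open_def carrier_S_inf)
    ultimately have "coin_measurable ?F"
      using universally_measurable_imp_coin_measurable by simp
    then obtain f :: "(nat \<Rightarrow> bool) \<Rightarrow> 'a" where f: "continuous_map cantor T f"
      "\<And>x y. x \<noteq> y \<Longrightarrow> inv (f x) \<otimes> f y \<notin> ?F"
      using cantor_transversal_if_not_open[OF F _ not_open] by metis
    have fc: "f x \<in> carrier G" for x
      using continuous_map_image_subset_topspace[OF f(1)] topspace_eq_carrier by auto
    have "inj (\<lambda>x. \<pi> (f x) n)"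
    proof (rule injI, rule ccontr)
      fix x y assume "\<pi> (f x) n = \<pi> (f y) n" "x \<noteq> y"
      then have "inv (f x) \<otimes> f y \<in> ?F" using quot fc by simp
      with f(2)[OF \<open>x \<noteq> y\<close>] show False ..
    qed
    then show False using no_injection_cantor_nat by blast
  qed
  have fibre_open: "openin T {x \<in> carrier G. \<pi> x n = m}" for n m
  proof (subst openin_subopen, intro ballI)
    fix x assume x: "x \<in> {x \<in> carrier G. \<pi> x n = m}"
    let ?W = "{y \<in> carrier G. inv x \<otimes> y \<in> {z \<in> carrier G. \<pi> z n = n}}"
    have "openin T ?W"
      using x stab_open by (intro openin_preimage continuous_map_group_intros) auto
    moreover have "x \<in> ?W" "?W \<subseteq> {x \<in> carrier G. \<pi> x n = m}" using x quot one by auto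
    ultimately show "\<exists>W. openin T W \<and> x \<in> W \<and> W \<subseteq> {x \<in> carrier G. \<pi> x n = m}" by blast
  qed
  show ?thesis
    unfolding S_inf_topology_def
  proof (rule continuous_on_generated_topo)
    fix U assume "U \<in> {S_inf_basic_open P |P. finite P}"
    then obtain P where P: "finite P" "U = S_inf_basic_open P" by blast
    have "\<pi> -` U \<inter> topspace T = (\<Inter>p\<in>P. {x \<in> carrier G. \<pi> x (fst p) = snd p}) \<inter> topspace T"
      using bij topspace_eq_carrier by (fastforce simp: P S_inf_basic_open_def carrier_S_inf)
    then show "openin T (\<pi> -` U \<inter> topspace T)"
      using P(1) fibre_open by (simp add: openin_INT)
  next
    have "S_inf_basic_open {} = carrier S_inf"
      by (simp add: S_inf_basic_open_def)
    then have "carrier S_inf \<in> {S_inf_basic_open P |P. finite P}"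
      by (metis (mono_tags, lifting) finite.emptyI mem_Collect_eq)
    then show "\<pi> ` topspace T \<subseteq> \<Union> {S_inf_basic_open P |P. finite P}"
      using bij topspace_eq_carrier carrier_S_inf by blast
  qed
qed

theorem theorem1:
  fixes G :: "('a, 'b) monoid_scheme" and T :: "'a topology"
  assumes "polish_group G T"
  shows "(\<forall>F. subgroup F G \<and> universally_measurable T F \<longrightarrow>
            openin T F \<or> has_perfect_index G T F) \<and>
         (\<forall>\<pi>. \<pi> \<in> hom G S_inf \<and> universally_measurable_map T S_inf_topology \<pi> \<longrightarrow>
            continuous_map T S_inf_topology \<pi>)"
proof -
  interpret polish_group G T by fact
  have "openin T F \<or> has_perfect_index G T F"
    if F: "subgroup F G" "universally_measurable T F" for F
    using cantor_transversal_if_not_open[OF F(1) universally_measurable_imp_coin_measurable[OF F(2)]]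
      perfect_index_if_cantor_transversal[OF F(1)] by metis
  then show ?thesis using universally_measurable_hom_continuous by blast
qed

end
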